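(* Let $A\in\mathbb{R}^{n\times n}$, let $$M_{\mathrm{AECS}}=\begin{pmatrix}q_{-,1}\otimes q_{-,1}&\cdots&q_{-,n}\otimes q_{-,n}\end{pmatrix}\in\mathbb{C}^{n_-^2\times n},$$ and assume $\mathrm{rank}\,M_{\mathrm{AECS}}=n$. Then the infinite-horizon AECS problem $$\text{minimize}_{p}\ \mathrm{tr}\bigl(Q^{-*}\,\mathrm{diag}(W_-(p)^{-1},O,O)\,Q^{-1}\bigr)\quad\text{subject to } p\in\Delta,\ W_-(p)\succ O$$ admits a unique optimal solution.
   Context: Notation: $\Delta=\{p\in\mathbb{R}^n\mid p_i\ge0,\ \sum_ip_i=1\}$; $X\succ O$ means $X$ is Hermitian positive definite; $\otimes$ is the Kronecker product; $e_i$ is the $i$-th standard basis vector; $X^*$ is the conjugate transpose, $X^{-*}=(X^{-1})^*$; $\mathrm{diag}$ of square matrices is the block-diagonal matrix; $I_k$ is the identity and $N_k$ is the $k\times k$ nilpotent Jordan block with ones on the superdiagonal. Jordan form: fix a Jordan decomposition $Q^{-1}AQ=J=\mathrm{diag}(J_1,\dots,J_m)$, $Q\in\mathbb{C}^{n\times n}$ invertible, $J_i=\lambda_iI_{n_i}+N_{n_i}\in\mathbb{C}^{n_i\times n_i}$, with blocks ordered so that $\mathrm{Re}(\lambda_i)<0$ for $i\le m_-$, $\mathrm{Re}(\lambda_i)=0$ for $m_-<i\le m_-+m_0$, $\mathrm{Re}(\lambda_i)>0$ for $i>m_-+m_0$, and $\mathrm{Im}(\lambda_{m_-+1})\le\cdots\le\mathrm{Im}(\lambda_{m_-+m_0})$.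 Let $n_-,n_0,n_+$ be the total sizes of the blocks in the three groups and $J_-=\mathrm{diag}(J_1,\dots,J_{m_-})\in\mathbb{C}^{n_-\times n_-}$. The infinite-horizon AECS problem is formulated when $n_-\ge1$. $q_{-,i}\in\mathbb{C}^{n_-}$ denotes the vector of the first $n_-$ entries of $Q^{-1}e_i$. For $p\in\mathbb{R}^n$, let $\widetilde B_{-,-}\in\mathbb{C}^{n_-\times n_-}$ be the upper-left $n_-\times n_-$ block of $Q^{-1}\mathrm{diag}(p)Q^{-*}$; $W_-(p)$ is the unique solution of $J_-W_-(p)+W_-(p)J_-^*+\widetilde B_{-,-}=O$. In $\mathrm{diag}(W_-(p)^{-1},O,O)$ the zero blocks have sizes $n_0\times n_0$ and $n_+\times n_+$. *)

theory Defs
  imports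
    "Jordan_Normal_Form.Jordan_Normal_Form"
    "Jordan_Normal_Form.Gauss_Jordan_Elimination"
    "Jordan_Normal_Form.Schur_Decomposition"
    "Jordan_Normal_Form.DL_Rank"
begin

text \<open>Only meaningful for invertible square matrices; an unspecified matrix otherwise.\<close>

definition mat_inv :: "complex mat \<Rightarrow> complex mat" where
  "mat_inv X = the (mat_inverse X)"

definition mat_trace :: "complex mat \<Rightarrow> complex" where
  "mat_trace X = (\<Sum>i<dim_row X. X $$ (i, i))"

text \<open>The order on \<^typ>\<open>complex\<close> is the partial one: \<open>0 < z\<close> means that \<open>z\<close> is real and positive.\<close>

definition pos_def :: "complex mat \<Rightarrow> bool" where
  "pos_def X \<longleftrightarrow> square_mat X \<and> mat_adjoint X = X \<and>
     (\<forall>v \<in> carrier_vec (dim_row X). v \<noteq> 0\<^sub>v (dim_row X) \<longrightarrow> 0 < (X *\<^sub>v v) \<bullet>c v)"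

definition vec_kron :: "complex vec \<Rightarrow> complex vec \<Rightarrow> complex vec" where
  "vec_kron u v = vec (dim_vec u * dim_vec v) (\<lambda>k. u $ (k div dim_vec v) * v $ (k mod dim_vec v))"

definition prob_simplex :: "nat \<Rightarrow> real vec set" where
  "prob_simplex n = {p \<in> carrier_vec n. (\<forall>i<n. 0 \<le> p $ i) \<and> (\<Sum>i<n. p $ i) = 1}"

text \<open>A Jordan block is given by its size and its eigenvalue, and \<open>bm\<close>, \<open>bz\<close>, \<open>bp\<close> list the
  blocks whose eigenvalues have negative, zero and positive real part.\<close>

type_synonym blocks = "(nat \<times> complex) list"

definition total_size :: "blocks \<Rightarrow> nat" where
  "total_size bs = sum_list (map fst bs)"

definition ordered_jordan_decomposition ::
  "complex mat \<Rightarrow> complex mat \<Rightarrow> blocks \<Rightarrow> blocks \<Rightarrow> blocks \<Rightarrow> bool" where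
  "ordered_jordan_decomposition A Q bm bz bp \<longleftrightarrow>
     Q \<in> carrier_mat (dim_row A) (dim_row A) \<and> invertible_mat Q \<and>
     mat_inv Q * A * Q = jordan_matrix (bm @ bz @ bp) \<and>
     (\<forall>(k, l) \<in> set (bm @ bz @ bp). 1 \<le> k) \<and>
     (\<forall>(k, l) \<in> set bm. Re l < 0) \<and>
     (\<forall>(k, l) \<in> set bz. Re l = 0) \<and>
     (\<forall>(k, l) \<in> set bp. 0 < Re l) \<and>
     sorted (map (\<lambda>(k, l). Im l) bz)"

definition q_minus :: "complex mat \<Rightarrow> blocks \<Rightarrow> nat \<Rightarrow> complex vec" where
  "q_minus Q bm i = vec_first (mat_inv Q *\<^sub>v unit_vec (dim_row Q) i) (total_size bm)"

definition M_AECS :: "complex mat \<Rightarrow> blocks \<Rightarrow> complex mat" where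
  "M_AECS Q bm = mat_of_cols ((total_size bm)\<^sup>2)
     (map (\<lambda>i. vec_kron (q_minus Q bm i) (q_minus Q bm i)) [0..<dim_row Q])"

definition B_minus :: "complex mat \<Rightarrow> blocks \<Rightarrow> real vec \<Rightarrow> complex mat" where
  "B_minus Q bm p =
     (let B = mat_inv Q * mat_diag (dim_row Q) (\<lambda>i. complex_of_real (p $ i)) * mat_adjoint (mat_inv Q)
      in mat (total_size bm) (total_size bm) (\<lambda>(i, j). B $$ (i, j)))"

definition W_minus :: "complex mat \<Rightarrow> blocks \<Rightarrow> real vec \<Rightarrow> complex mat" where
  "W_minus Q bm p =
     (THE W. W \<in> carrier_mat (total_size bm) (total_size bm) \<and>
        jordan_matrix bm * W + W * mat_adjoint (jordan_matrix bm) + B_minus Q bm p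
          = 0\<^sub>m (total_size bm) (total_size bm))"

definition aecs_feasible :: "complex mat \<Rightarrow> blocks \<Rightarrow> real vec set" where
  "aecs_feasible Q bm = {p \<in> prob_simplex (dim_row Q). pos_def (W_minus Q bm p)}"

text \<open>On the feasible set the matrix under the trace is Hermitian, so its trace is real and taking
  the real part is only a coercion.\<close>

definition aecs_cost :: "complex mat \<Rightarrow> blocks \<Rightarrow> blocks \<Rightarrow> blocks \<Rightarrow> real vec \<Rightarrow> real" where
  "aecs_cost Q bm bz bp p = Re (mat_trace
     (mat_adjoint (mat_inv Q) *
      diag_block_mat [mat_inv (W_minus Q bm p),
                      0\<^sub>m (total_size bz) (total_size bz),
                      0\<^sub>m (total_size bp) (total_size bp)] *
      mat_inv Q))"

definition aecs_optimal :: "complex mat \<Rightarrow> blocks \<Rightarrow> blocks \<Rightarrow> blocks \<Rightarrow> real vec \<Rightarrow> bool" where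
  "aecs_optimal Q bm bz bp p \<longleftrightarrow> p \<in> aecs_feasible Q bm \<and>
     (\<forall>r \<in> aecs_feasible Q bm. aecs_cost Q bm bz bp p \<le> aecs_cost Q bm bz bp r)"

end

theory Submission
  imports Defs
begin

text \<open>For \<open>W \<succ> 0\<close> one has \<open>q\<^sup>* W\<inverse> q = max\<^sub>x (2 Re (x\<^sup>* q) - x\<^sup>* W x)\<close>, attained exactly when \<open>W x = q\<close>.
  The cost is \<open>\<Sum>\<^sub>i q\<^sub>i\<^sup>* W(p)\<inverse> q\<^sub>i\<close> with \<open>W(p)\<close> linear in \<open>p\<close>, so it is a supremum of affine functions
  of \<open>p\<close>. Along a minimizing sequence in the simplex the affine bounds pass to the limit \<open>l\<close>;
  as the \<open>q\<^sub>i\<close> span the space, they would be unbounded if \<open>W(l)\<close> were singular, so \<open>l\<close> is feasible and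
  optimal. If \<open>p\<close> and \<open>r\<close> are both optimal, the maximizers for their midpoint also attain the maximum
  for \<open>p\<close> and for \<open>r\<close>, whence \<open>W(p) = W(r)\<close>. Since \<open>A\<close> is real, the conjugates of the \<open>q\<^sub>i\<close>
  are the images of the \<open>q\<^sub>i\<close> under one fixed matrix, so the rank condition on the \<open>q\<^sub>i \<otimes> q\<^sub>i\<close> makes
  the matrices \<open>q\<^sub>i q\<^sub>i\<^sup>*\<close> linearly independent over the reals and \<open>p \<mapsto> W(p)\<close> injective.\<close>

section \<open>Hermitian forms\<close>

lemma mat_adjoint_dim [simp]:
  "dim_row (mat_adjoint A) = dim_col A" "dim_col (mat_adjoint A) = dim_row A"
  by (auto simp: mat_adjoint_def)

lemma mat_adjoint_carrier [simp]:
  "A \<in> carrier_mat nr nc \<Longrightarrow> mat_adjoint A \<in> carrier_mat nc nr"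
  by (intro carrier_matI) (simp_all add: carrier_matD)

lemma mat_adjoint_index [simp]:
  fixes A :: "complex mat"
  assumes "i < dim_col A" "j < dim_row A"
  shows "mat_adjoint A $$ (i, j) = cnj (A $$ (j, i))"
  using assms by (simp add: mat_adjoint_def mat_of_rows_def)

lemma mat_adjoint_adjoint [simp]:
  fixes A :: "complex mat"
  shows "mat_adjoint (mat_adjoint A) = A"
  by (rule eq_matI) auto

lemma mat_adjoint_add:
  fixes A B :: "complex mat"
  assumes "A \<in> carrier_mat nr nc" "B \<in> carrier_mat nr nc"
  shows "mat_adjoint (A + B) = mat_adjoint A + mat_adjoint B"
  using assms by (intro eq_matI) (simp_all add: carrier_matD)

lemma mat_adjoint_mult:
  fixes A B :: "complex mat"
  assumes "A \<in> carrier_mat nr n" "B \<in> carrier_mat n nc"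
  shows "mat_adjoint (A * B) = mat_adjoint B * mat_adjoint A"
  using assms by (intro eq_matI) (auto simp: scalar_prod_def mult.commute intro!: sum.cong)

lemma cscalar_prod_adjoint:
  fixes A :: "complex mat"
  assumes "A \<in> carrier_mat nr nc" "x \<in> carrier_vec nc" "y \<in> carrier_vec nr"
  shows "(A *\<^sub>v x) \<bullet>c y = x \<bullet>c (mat_adjoint A *\<^sub>v y)"
proof -
  have "(A *\<^sub>v x) \<bullet>c y = (\<Sum>i = 0..<nr. \<Sum>j = 0..<nc. A $$ (i, j) * x $ j * cnj (y $ i))"
    using assms by (auto simp: scalar_prod_def sum_distrib_right intro!: sum.cong)
  also have "\<dots> = (\<Sum>j = 0..<nc. \<Sum>i = 0..<nr. A $$ (i, j) * x $ j * cnj (y $ i))"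
    by (rule sum.swap)
  also have "\<dots> = x \<bullet>c (mat_adjoint A *\<^sub>v y)"
    using assms by (auto simp: scalar_prod_def sum_distrib_left mult_ac intro!: sum.cong)
  finally show ?thesis .
qed

lemma cscalar_prod_cnj:
  fixes x y :: "complex vec"
  assumes "x \<in> carrier_vec n" "y \<in> carrier_vec n"
  shows "cnj (x \<bullet>c y) = y \<bullet>c x"
  using assms by (auto simp: scalar_prod_def mult.commute intro!: sum.cong)

lemma hermitian_cscalar_prod_swap:
  fixes W :: "complex mat"
  assumes "W \<in> carrier_mat n n" "mat_adjoint W = W" "x \<in> carrier_vec n" "y \<in> carrier_vec n"
  shows "(W *\<^sub>v x) \<bullet>c y = cnj ((W *\<^sub>v y) \<bullet>c x)"
proof -
  have "(W *\<^sub>v x) \<bullet>c y = x \<bullet>c (W *\<^sub>v y)"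
    using cscalar_prod_adjoint[OF assms(1,3,4)] assms(2) by simp
  thus ?thesis
    using assms by (subst cscalar_prod_cnj[where n = n]) auto
qed

lemma hermitian_form_real:
  fixes W :: "complex mat"
  assumes "W \<in> carrier_mat n n" "mat_adjoint W = W" "x \<in> carrier_vec n"
  shows "Im ((W *\<^sub>v x) \<bullet>c x) = 0"
  using arg_cong[OF hermitian_cscalar_prod_swap[OF assms assms(3)], of Im] by simp

text \<open>Hermitian forms are real, so the partial order on \<open>complex\<close> only tests the
  real part. From here on positivity is a matter of real inequalities.\<close>

lemma pos_def_iff:
  assumes "W \<in> carrier_mat n n"
  shows "pos_def W \<longleftrightarrow> mat_adjoint W = W \<and>
    (\<forall>x \<in> carrier_vec n. x \<noteq> 0\<^sub>v n \<longrightarrow> 0 < Re ((W *\<^sub>v x) \<bullet>c x))"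
  using assms hermitian_form_real[OF assms] by (auto simp: pos_def_def less_complex_def)

lemma pos_def_form_nonneg:
  assumes "W \<in> carrier_mat n n" "pos_def W" "x \<in> carrier_vec n"
  shows "0 \<le> Re ((W *\<^sub>v x) \<bullet>c x)"
proof (cases "x = 0\<^sub>v n")
  case True
  then have "W *\<^sub>v x = 0\<^sub>v n"
    using assms(1) by auto
  with True show ?thesis
    by simp
next
  case False
  with assms show ?thesis
    by (auto simp: pos_def_iff less_eq_real_def)
qed

lemma form_add:
  fixes W :: "complex mat"
  assumes "W \<in> carrier_mat n n" "x \<in> carrier_vec n" "y \<in> carrier_vec n"
  shows "(W *\<^sub>v (x + y)) \<bullet>c (x + y) =
    (W *\<^sub>v x) \<bullet>c x + (W *\<^sub>v y) \<bullet>c x + (W *\<^sub>v x) \<bullet>c y + (W *\<^sub>v y) \<bullet>c y"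
proof -
  have "(W *\<^sub>v (x + y)) \<bullet>c (x + y) = (W *\<^sub>v x + W *\<^sub>v y) \<bullet> (conjugate x + conjugate y)"
    using assms by (simp add: mult_add_distrib_mat_vec[OF assms] conjugate_add_vec[of _ n])
  also have "\<dots> = (W *\<^sub>v x + W *\<^sub>v y) \<bullet>c x + (W *\<^sub>v x + W *\<^sub>v y) \<bullet>c y"
    using assms by (intro scalar_prod_add_distrib[of _ n]) auto
  also have "\<dots> = (W *\<^sub>v x) \<bullet>c x + (W *\<^sub>v y) \<bullet>c x + ((W *\<^sub>v x) \<bullet>c y + (W *\<^sub>v y) \<bullet>c y)"
    using assms by (subst (1 2) add_scalar_prod_distrib[of _ n]) auto
  finally show ?thesis by simp
qed

lemma form_smult:
  fixes W :: "complex mat"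
  assumes "W \<in> carrier_mat n n" "x \<in> carrier_vec n" "y \<in> carrier_vec n"
  shows "(W *\<^sub>v (c \<cdot>\<^sub>v x)) \<bullet>c y = c * ((W *\<^sub>v x) \<bullet>c y)"
    and "(W *\<^sub>v x) \<bullet>c (c \<cdot>\<^sub>v y) = cnj c * ((W *\<^sub>v x) \<bullet>c y)"
  using assms by (auto simp: mult_mat_vec[OF assms(1)] conjugate_smult_vec)

section \<open>Inverses and invertibility of positive definite matrices\<close>

lemma mat_inv_invertible:
  assumes "W \<in> carrier_mat n n" "invertible_mat W"
  shows "mat_inv W \<in> carrier_mat n n" "W * mat_inv W = 1\<^sub>m n" "mat_inv W * W = 1\<^sub>m n"
proof -
  obtain V where "inverts_mat W V" "inverts_mat V W"
    using assms(2) unfolding invertible_mat_def by blast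
  then have V: "W * V = 1\<^sub>m n" "V * W = 1\<^sub>m (dim_row V)"
    using assms(1) by (simp_all add: inverts_mat_def)
  \<comment> \<open>\<open>inverts_mat\<close> leaves the shape of \<open>V\<close> open; comparing
    dimensions in the two products shows that it is square of size \<open>n\<close>.\<close>
  have dV: "V \<in> carrier_mat n n"
  proof (rule carrier_matI)
    show "dim_row V = n"
      using arg_cong[OF V(2), of dim_col] carrier_matD(2)[OF assms(1)] by simp
    show "dim_col V = n"
      using arg_cong[OF V(1), of dim_col] by simp
  qed
  \<comment> \<open>Being a unit rules out the failure value \<open>None\<close> of
    \<open>mat_inverse\<close>, so \<open>the\<close> in \<open>mat_inv\<close> is applied to a
    genuine inverse.\<close>
  then have "W \<in> Units (ring_mat TYPE(complex) n ())"
    using V assms(1) carrier_matD(1)[OF dV] unfolding Units_def ring_mat_simps by blast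
  then obtain U where U: "mat_inverse W = Some U"
    using mat_inverse(1)[OF assms(1), of "()"] by (cases "mat_inverse W") auto
  from mat_inverse(2)[OF assms(1) U]
  show "mat_inv W \<in> carrier_mat n n" "W * mat_inv W = 1\<^sub>m n" "mat_inv W * W = 1\<^sub>m n"
    using U by (auto simp: mat_inv_def)
qed

lemma invertible_mat_if_inj:
  fixes W :: "complex mat"
  assumes W: "W \<in> carrier_mat n n"
    and inj: "\<And>x. x \<in> carrier_vec n \<Longrightarrow> W *\<^sub>v x = 0\<^sub>v n \<Longrightarrow> x = 0\<^sub>v n"
  shows "invertible_mat W"
proof -
  have "det W \<noteq> 0"
    using det_0_iff_vec_prod_zero_field[OF W] inj by blast
  from det_non_zero_imp_unit[OF W this, of "()"]
  show ?thesis
    using W unfolding Units_def ring_mat_simps invertible_mat_def inverts_mat_def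
    by auto
qed

lemma pos_def_invertible:
  assumes W: "W \<in> carrier_mat n n" and "pos_def W"
  shows "invertible_mat W"
proof (rule invertible_mat_if_inj[OF W])
  fix x :: "complex vec"
  assume x: "x \<in> carrier_vec n" "W *\<^sub>v x = 0\<^sub>v n"
  then have "Re ((W *\<^sub>v x) \<bullet>c x) = 0"
    by (simp add: scalar_prod_left_zero[OF carrier_vec_conjugate])
  then show "x = 0\<^sub>v n"
    using assms x(1) by (auto simp: pos_def_iff[OF W])
qed

section \<open>Variational formula for the form of the inverse\<close>

lemma hermitian_form_diff:
  fixes W :: "complex mat"
  assumes W: "W \<in> carrier_mat n n" "mat_adjoint W = W"
    and xy: "x \<in> carrier_vec n" "y \<in> carrier_vec n"
  shows "Re ((W *\<^sub>v (x - y)) \<bullet>c (x - y)) =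
    Re ((W *\<^sub>v x) \<bullet>c x) - 2 * Re ((W *\<^sub>v x) \<bullet>c y) + Re ((W *\<^sub>v y) \<bullet>c y)"
proof -
  have eq: "x - y = x + (- 1) \<cdot>\<^sub>v y"
    using xy by (intro eq_vecI) auto
  have "Re ((W *\<^sub>v y) \<bullet>c x) = Re ((W *\<^sub>v x) \<bullet>c y)"
    by (subst hermitian_cscalar_prod_swap[OF W xy(2,1)]) simp
  then show ?thesis
    unfolding eq using W xy
    by (subst form_add[of _ n]) (auto simp: form_smult[of W n])
qed

text \<open>Completing the square: with \<open>y = mat_inv W *\<^sub>v q\<close>, the gap between
  the two sides is the form of \<open>W\<close> at \<open>y - x\<close>, which is nonnegative and
  vanishes only for \<open>x = y\<close>.\<close>

lemma dual_form_bound: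
  assumes W: "W \<in> carrier_mat n n" "pos_def W"
    and q: "q \<in> carrier_vec n" and x: "x \<in> carrier_vec n"
  shows "2 * Re (q \<bullet>c x) - Re ((W *\<^sub>v x) \<bullet>c x) \<le> Re ((mat_inv W *\<^sub>v q) \<bullet>c q)"
    and "2 * Re (q \<bullet>c x) - Re ((W *\<^sub>v x) \<bullet>c x) = Re ((mat_inv W *\<^sub>v q) \<bullet>c q) \<longleftrightarrow> W *\<^sub>v x = q"
proof -
  note inv = mat_inv_invertible[OF W(1) pos_def_invertible[OF W]]
  define y where "y = mat_inv W *\<^sub>v q"
  have y: "y \<in> carrier_vec n"
    using inv(1) q by (auto simp: y_def)
  have Wy: "W *\<^sub>v y = q"
    unfolding y_def using inv W(1) q by (subst assoc_mult_mat_vec[symmetric, of _ n n _ n]) auto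
  have yW: "mat_inv W *\<^sub>v (W *\<^sub>v x) = x"
    using inv W(1) x by (subst assoc_mult_mat_vec[symmetric, of _ n n _ n]) auto
  have herm: "mat_adjoint W = W"
    using W by (simp add: pos_def_iff)
  have "Re ((W *\<^sub>v (y - x)) \<bullet>c (y - x)) =
      Re (q \<bullet>c y) - 2 * Re (q \<bullet>c x) + Re ((W *\<^sub>v x) \<bullet>c x)"
    using hermitian_form_diff[OF W(1) herm y x] Wy by simp
  moreover have "Re (q \<bullet>c y) = Re (y \<bullet>c q)"
    using cscalar_prod_cnj[OF q y] by (metis cnj.simps(1))
  ultimately have key: "Re (y \<bullet>c q) - (2 * Re (q \<bullet>c x) - Re ((W *\<^sub>v x) \<bullet>c x)) =
      Re ((W *\<^sub>v (y - x)) \<bullet>c (y - x))"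
    by simp
  show "2 * Re (q \<bullet>c x) - Re ((W *\<^sub>v x) \<bullet>c x) \<le> Re ((mat_inv W *\<^sub>v q) \<bullet>c q)"
    using key pos_def_form_nonneg[OF W, of "y - x"] x y by (auto simp: y_def)
  show "2 * Re (q \<bullet>c x) - Re ((W *\<^sub>v x) \<bullet>c x) = Re ((mat_inv W *\<^sub>v q) \<bullet>c q) \<longleftrightarrow> W *\<^sub>v x = q"
  proof
    assume "2 * Re (q \<bullet>c x) - Re ((W *\<^sub>v x) \<bullet>c x) = Re ((mat_inv W *\<^sub>v q) \<bullet>c q)"
    then have "Re ((W *\<^sub>v (y - x)) \<bullet>c (y - x)) = 0"
      using key by (simp add: y_def)
    then have "y - x = 0\<^sub>v n"
      using W x y by (metis minus_carrier_vec less_irrefl pos_def_iff)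
    then have "(y - x) $ i = 0" if "i < n" for i
      using that by simp
    then have "y $ i = x $ i" if "i < n" for i
      using that x y by simp
    then have "y = x"
      using x y by auto
    then show "W *\<^sub>v x = q"
      using Wy by simp
  next
    assume "W *\<^sub>v x = q"
    then have "y = x"
      using yW by (simp add: y_def)
    then show "2 * Re (q \<bullet>c x) - Re ((W *\<^sub>v x) \<bullet>c x) = Re ((mat_inv W *\<^sub>v q) \<bullet>c q)"
      using Wy \<open>Re (q \<bullet>c y) = Re (y \<bullet>c q)\<close> by (simp add: y_def)
  qed
qed

section \<open>The Lyapunov equation of a stable triangular matrix\<close>

lemma upper_triangular_row_sum:
  fixes c f :: "nat \<Rightarrow> complex"
  assumes "i < N" "\<And>k. k < i \<Longrightarrow> c k = 0"
  shows "(\<Sum>k = 0..<N. c k * f k) = c i * f i + (\<Sum>k \<in> {i<..<N}. c k * f k)"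
proof -
  have "(\<Sum>k = 0..<N. c k * f k) = (\<Sum>k \<in> insert i {i<..<N}. c k * f k)"
    using assms by (intro sum.mono_neutral_right) auto
  then show ?thesis by simp
qed

text \<open>Triangularity isolates the coefficient of \<open>W $$ (i, j)\<close>: every other entry
  of \<open>W\<close> that occurs lies further down in the same column or further right in the same
  row. This is what makes back substitution possible.\<close>

lemma lyapunov_entry:
  fixes T W :: "complex mat"
  assumes T: "T \<in> carrier_mat N N" "\<And>i j. i < N \<Longrightarrow> j < i \<Longrightarrow> T $$ (i, j) = 0"
    and W: "W \<in> carrier_mat N N" and ij: "i < N" "j < N"
  shows "(T * W + W * mat_adjoint T) $$ (i, j) = (T $$ (i, i) + cnj (T $$ (j, j))) * W $$ (i, j) +
    (\<Sum>k \<in> {i<..<N}. T $$ (i, k) * W $$ (k, j)) + (\<Sum>k \<in> {j<..<N}. W $$ (i, k) * cnj (T $$ (j, k)))"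
proof -
  have "(T * W) $$ (i, j) = (\<Sum>k = 0..<N. T $$ (i, k) * W $$ (k, j))"
    using T(1) W ij by (simp add: scalar_prod_def)
  moreover have "(W * mat_adjoint T) $$ (i, j) = (\<Sum>k = 0..<N. cnj (T $$ (j, k)) * W $$ (i, k))"
    using T(1) W ij by (simp add: scalar_prod_def mult.commute)
  moreover have "(T * W + W * mat_adjoint T) $$ (i, j) = (T * W) $$ (i, j) + (W * mat_adjoint T) $$ (i, j)"
    using T(1) W ij by simp
  moreover have "(\<Sum>k = 0..<N. cnj (T $$ (j, k)) * W $$ (i, k)) =
      cnj (T $$ (j, j)) * W $$ (i, j) + (\<Sum>k \<in> {j<..<N}. cnj (T $$ (j, k)) * W $$ (i, k))"
    by (rule upper_triangular_row_sum) (use ij T(2) in auto)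
  moreover have "(\<Sum>k = 0..<N. T $$ (i, k) * W $$ (k, j)) =
      T $$ (i, i) * W $$ (i, j) + (\<Sum>k \<in> {i<..<N}. T $$ (i, k) * W $$ (k, j))"
    by (rule upper_triangular_row_sum) (use ij T(2) in auto)
  ultimately show ?thesis
    by (simp add: algebra_simps)
qed

text \<open>Back substitution starting from the lower right corner; each recursive call increases
  one of the two indices. The value 0 outside the range is a filler that the sums never
  read.\<close>

function lyapunov_sol ::
  "nat \<Rightarrow> complex mat \<Rightarrow> complex mat \<Rightarrow> nat \<Rightarrow> nat \<Rightarrow> complex" where
  "lyapunov_sol N T B i j =
    (if i < N \<and> j < N then
       - (B $$ (i, j) + (\<Sum>k \<in> {i<..<N}. T $$ (i, k) * lyapunov_sol N T B k j) +
          (\<Sum>k \<in> {j<..<N}. lyapunov_sol N T B i k * cnj (T $$ (j, k)))) / (T $$ (i, i) + cnj (T $$ (j, j)))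
     else 0)"
  by pat_completeness auto
termination
  by (relation "measure (\<lambda>(N, T, B, i, j). (N - i) + (N - j))") auto

declare lyapunov_sol.simps [simp del]

text \<open>By induction on the distance from the lower right corner, the entries in both sums of
  \<open>lyapunov_entry\<close> are already zero, which leaves a nonzero coefficient times the
  entry.\<close>

lemma lyapunov_homogeneous:
  fixes T X :: "complex mat"
  assumes T: "T \<in> carrier_mat N N" "\<And>i j. i < N \<Longrightarrow> j < i \<Longrightarrow> T $$ (i, j) = 0"
    and nz: "\<And>i j. i < N \<Longrightarrow> j < N \<Longrightarrow> T $$ (i, i) + cnj (T $$ (j, j)) \<noteq> 0"
    and X: "X \<in> carrier_mat N N" "T * X + X * mat_adjoint T = 0\<^sub>m N N"
  shows "X = 0\<^sub>m N N"
proof -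
  have "X $$ (i, j) = 0" if "i < N" "j < N" for i j
    using that
  proof (induction "(N - i) + (N - j)" arbitrary: i j rule: less_induct)
    case less
    have "(\<Sum>k \<in> {i<..<N}. T $$ (i, k) * X $$ (k, j)) = 0"
      using less.prems by (intro sum.neutral) (auto intro!: less.hyps)
    moreover have "(\<Sum>k \<in> {j<..<N}. X $$ (i, k) * cnj (T $$ (j, k))) = 0"
      using less.prems by (intro sum.neutral) (auto intro!: less.hyps)
    ultimately have "(T $$ (i, i) + cnj (T $$ (j, j))) * X $$ (i, j) = 0"
      using lyapunov_entry[OF T X(1) less.prems] X(2) less.prems by simp
    then show ?case
      using nz[OF less.prems] by simp
  qed
  then show ?thesis
    using X(1) by (intro eq_matI) auto
qed

text \<open>Back substitution gives existence; the difference of two solutions solves the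
  homogeneous equation, which gives uniqueness.\<close>

lemma lyapunov_ex1:
  fixes T B :: "complex mat"
  assumes T: "T \<in> carrier_mat N N" "\<And>i j. i < N \<Longrightarrow> j < i \<Longrightarrow> T $$ (i, j) = 0"
    and nz: "\<And>i j. i < N \<Longrightarrow> j < N \<Longrightarrow> T $$ (i, i) + cnj (T $$ (j, j)) \<noteq> 0"
    and B: "B \<in> carrier_mat N N"
  shows "\<exists>!W. W \<in> carrier_mat N N \<and> T * W + W * mat_adjoint T + B = 0\<^sub>m N N"
proof (rule ex_ex1I)
  define W where "W = mat N N (\<lambda>(i, j). lyapunov_sol N T B i j)"
  have W: "W \<in> carrier_mat N N"
    by (simp add: W_def)
  have "(T * W + W * mat_adjoint T) $$ (i, j) + B $$ (i, j) = 0" if "i < N" "j < N" for i j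
  proof -
    have "(\<Sum>k \<in> {i<..<N}. T $$ (i, k) * W $$ (k, j)) = (\<Sum>k \<in> {i<..<N}. T $$ (i, k) * lyapunov_sol N T B k j)"
      using that by (intro sum.cong) (auto simp: W_def)
    moreover have "(\<Sum>k \<in> {j<..<N}. W $$ (i, k) * cnj (T $$ (j, k))) =
        (\<Sum>k \<in> {j<..<N}. lyapunov_sol N T B i k * cnj (T $$ (j, k)))"
      using that by (intro sum.cong) (auto simp: W_def)
    moreover have "(T $$ (i, i) + cnj (T $$ (j, j))) * W $$ (i, j) =
       - (B $$ (i, j) + (\<Sum>k \<in> {i<..<N}. T $$ (i, k) * lyapunov_sol N T B k j) +
          (\<Sum>k \<in> {j<..<N}. lyapunov_sol N T B i k * cnj (T $$ (j, k))))"
      using that nz[OF that] by (simp add: W_def lyapunov_sol.simps[of N T B i j])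
    ultimately show ?thesis
      by (simp add: lyapunov_entry[OF T W that])
  qed
  then have "T * W + W * mat_adjoint T + B = 0\<^sub>m N N"
    using T(1) W B by (intro eq_matI) auto
  with W show "\<exists>W. W \<in> carrier_mat N N \<and> T * W + W * mat_adjoint T + B = 0\<^sub>m N N"
    by blast
next
  fix V W
  assume V: "V \<in> carrier_mat N N \<and> T * V + V * mat_adjoint T + B = 0\<^sub>m N N"
    and W: "W \<in> carrier_mat N N \<and> T * W + W * mat_adjoint T + B = 0\<^sub>m N N"
  have eq: "T * (V - W) + (V - W) * mat_adjoint T = 0\<^sub>m N N"
  proof (rule eq_matI)
    fix i j assume "i < dim_row (0\<^sub>m N N)" "j < dim_col (0\<^sub>m N N)"
    then have ij: "i < N" "j < N"
      by auto
    have c: "V \<in> carrier_mat N N" "W \<in> carrier_mat N N" "mat_adjoint T \<in> carrier_mat N N"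
      using V W T(1) by auto
    have "(T * V + V * mat_adjoint T + B) $$ (i, j) = 0" "(T * W + W * mat_adjoint T + B) $$ (i, j) = 0"
      using V W ij by auto
    then have "(T * V) $$ (i, j) + (V * mat_adjoint T) $$ (i, j) + B $$ (i, j) = 0"
      "(T * W) $$ (i, j) + (W * mat_adjoint T) $$ (i, j) + B $$ (i, j) = 0"
      using T(1) c B ij by auto
    then have "(T * V) $$ (i, j) + (V * mat_adjoint T) $$ (i, j) = (T * W) $$ (i, j) + (W * mat_adjoint T) $$ (i, j)"
      by (metis add_right_imp_eq)
    then show "(T * (V - W) + (V - W) * mat_adjoint T) $$ (i, j) = 0\<^sub>m N N $$ (i, j)"
      using T(1) c ij
      by (simp add: mult_minus_distrib_mat[OF T(1) c(1,2)] minus_mult_distrib_mat[OF c(1,2,3)] algebra_simps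
          del: index_mult_mat(1))
  qed (use T(1) V W in auto)
  have VW: "V - W \<in> carrier_mat N N"
    using V W by auto
  have "V - W = 0\<^sub>m N N"
    by (rule lyapunov_homogeneous[OF T nz VW eq])
  then have "(V - W) $$ (i, j) = 0" if "i < N" "j < N" for i j
    using that by simp
  then show "V = W"
    using V W by (intro eq_matI) auto
qed

text \<open>The form is positive on vectors supported beyond \<open>k\<close>, so the trailing block
  of \<open>W\<close> is invertible. Hence the entries of column \<open>k\<close> below the diagonal
  can be cancelled by adding to the unit vector at \<open>k\<close> a vector \<open>s\<close>
  supported beyond \<open>k\<close>.\<close>

lemma schur_complement_vector:
  assumes W: "W \<in> carrier_mat N N" and k: "k < N"
    and pos: "\<And>x. x \<in> carrier_vec N \<Longrightarrow> \<forall>i < Suc k. x $ i = 0 \<Longrightarrow> x \<noteq> 0\<^sub>v N \<Longrightarrow> 0 < Re ((W *\<^sub>v x) \<bullet>c x)"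
  obtains y where "y \<in> carrier_vec N" "\<And>i. i < k \<Longrightarrow> y $ i = 0" "y $ k = 1"
    "\<And>j. k < j \<Longrightarrow> j < N \<Longrightarrow> (W *\<^sub>v y) $ j = 0"
proof -
  \<comment> \<open>The trailing block of \<open>W\<close>, padded by an identity on the indices up
    to \<open>k\<close>. The padding keeps the size \<open>N\<close> and forces a solution to vanish
    up to \<open>k\<close> whenever the right-hand side does.\<close>
  define M where "M = mat N N (\<lambda>(i, j). if i \<le> k \<or> j \<le> k then (if i = j then 1 else 0) else W $$ (i, j))"
  have M: "M \<in> carrier_mat N N"
    by (simp add: M_def)
  have low: "(M *\<^sub>v v) $ i = v $ i" if "v \<in> carrier_vec N" "i \<le> k" for v i
  proof -
    have "(M *\<^sub>v v) $ i = (\<Sum>j = 0..<N. M $$ (i, j) * v $ j)"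
      using that k M by (simp add: scalar_prod_def)
    also have "\<dots> = (\<Sum>j = 0..<N. (if j = i then v $ j else 0))"
      using that k by (intro sum.cong) (auto simp: M_def)
    also have "\<dots> = v $ i"
      using that k by simp
    finally show ?thesis .
  qed
  have high: "(M *\<^sub>v v) $ i = (W *\<^sub>v v) $ i" if "v \<in> carrier_vec N" "\<forall>j \<le> k. v $ j = 0" "k < i" "i < N" for v i
    using that W by (auto simp: M_def scalar_prod_def intro!: sum.cong)
  have inv: "invertible_mat M"
  proof (rule invertible_mat_if_inj[OF M])
    fix v assume v: "v \<in> carrier_vec N" "M *\<^sub>v v = 0\<^sub>v N"
    have v0: "v $ i = 0" if "i \<le> k" for i
      using low[OF v(1) that] v(2) that k by simp
    have "(W *\<^sub>v v) $ i = 0" if "k < i" "i < N" for i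
      using high[OF v(1) _ that] v0 v(2) that by simp
    then have "(W *\<^sub>v v) \<bullet>c v = 0"
      using v0 v(1) W by (auto simp: scalar_prod_def simp del: index_mult_mat_vec intro!: sum.neutral) (metis not_less)
    then show "v = 0\<^sub>v N"
      using pos[OF v(1)] v0 by fastforce
  qed
  note Mi = mat_inv_invertible[OF M inv]
  define u where "u = vec N (\<lambda>i. if i \<le> k then 0 else - W $$ (i, k))"
  define s where "s = mat_inv M *\<^sub>v u"
  have s: "s \<in> carrier_vec N"
    using Mi(1) by (auto simp: s_def u_def)
  have Ms: "M *\<^sub>v s = u"
    unfolding s_def using Mi M by (subst assoc_mult_mat_vec[symmetric, of _ N N _ N]) (auto simp: u_def)
  have s0: "s $ i = 0" if "i \<le> k" for i
    using low[OF s that] that k by (simp add: Ms u_def)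
  have Ws: "(W *\<^sub>v s) $ j = - W $$ (j, k)" if "k < j" "j < N" for j
    using high[OF s _ that] s0 that by (simp add: Ms u_def)
  show ?thesis
  proof (rule that[of "unit_vec N k + s"])
    fix j assume j: "k < j" "j < N"
    have "W *\<^sub>v (unit_vec N k + s) = W *\<^sub>v unit_vec N k + W *\<^sub>v s"
      using W s by (intro mult_add_distrib_mat_vec) auto
    moreover have "(W *\<^sub>v unit_vec N k) $ j = W $$ (j, k)"
      using W k j by simp
    ultimately show "(W *\<^sub>v (unit_vec N k + s)) $ j = 0"
      using W s j Ws[OF j] by (simp del: index_mult_mat_vec)
  qed (use s s0 k in auto)
qed

text \<open>The form of \<open>W\<close> is shown to be positive on the vectors supported on \<open>{k..<N}\<close>, by downward
  induction on \<open>k\<close>. If \<open>y\<close> is the vector of the previous lemma, then \<open>W y\<close> vanishes beyond \<open>k\<close> and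
  \<open>T\<close> is upper triangular, so \<open>y\<^sup>* T W y = T\<^sub>k\<^sub>k (y\<^sup>* W y)\<close>, and the equation becomes
  \<open>2 Re T\<^sub>k\<^sub>k (y\<^sup>* W y) = - y\<^sup>* B y < 0\<close>.\<close>

lemma lyapunov_pos_def:
  assumes T: "T \<in> carrier_mat N N" "\<And>i j. i < N \<Longrightarrow> j < i \<Longrightarrow> T $$ (i, j) = 0"
    and stable: "\<And>i. i < N \<Longrightarrow> Re (T $$ (i, i)) < 0"
    and W: "W \<in> carrier_mat N N" "mat_adjoint W = W"
    and B: "B \<in> carrier_mat N N" "pos_def B"
    and eq: "T * W + W * mat_adjoint T + B = 0\<^sub>m N N"
  shows "pos_def W"
proof -
  have pos: "0 < Re ((W *\<^sub>v x) \<bullet>c x)"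
    if "k \<le> N" "x \<in> carrier_vec N" "\<forall>i < k. x $ i = 0" "x \<noteq> 0\<^sub>v N" for k x
    using that
  proof (induction k arbitrary: x rule: inc_induct)
    case base
    then have "x = 0\<^sub>v N"
      by (intro eq_vecI) auto
    with base show ?case by simp
  next
    case (step k)
    have k: "k < N"
      using step.hyps by simp
    obtain y where y: "y \<in> carrier_vec N" "\<And>i. i < k \<Longrightarrow> y $ i = 0" "y $ k = 1"
      and Wy: "\<And>j. k < j \<Longrightarrow> j < N \<Longrightarrow> (W *\<^sub>v y) $ j = 0"
      using schur_complement_vector[OF W(1) k step.IH] by blast
    define w where "w = W *\<^sub>v y"
    have w: "w \<in> carrier_vec N"
      using W(1) y(1) by (simp add: w_def)
    have w0: "w $ j = 0" if "k < j" "j < N" for j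
      using Wy[OF that] by (simp add: w_def)
    have wc: "w \<bullet>c v = w $ k * cnj (v $ k)" if "v \<in> carrier_vec N" "\<forall>i < k. v $ i = 0" for v
    proof -
      have "w \<bullet>c v = (\<Sum>i \<in> {0..<N}. w $ i * cnj (v $ i))"
        using that w by (simp add: scalar_prod_def)
      also have "\<dots> = (\<Sum>i \<in> {k}. w $ i * cnj (v $ i))"
        using that w0 k by (intro sum.mono_neutral_right) (auto, metis nat_neq_iff)
      finally show ?thesis by simp
    qed
    have Tw: "(T *\<^sub>v w) $ i = (if i = k then T $$ (k, k) * w $ k else 0)" if "k \<le> i" "i < N" for i
    proof -
      have "(T *\<^sub>v w) $ i = (\<Sum>j \<in> {0..<N}. T $$ (i, j) * w $ j)"
        using that w T(1) by (simp add: scalar_prod_def)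
      also have "\<dots> = (\<Sum>j \<in> {k}. T $$ (i, j) * w $ j)"
        using that w0 k T(2) by (intro sum.mono_neutral_right) (auto, metis nat_neq_iff order_less_le_trans)
      finally show ?thesis
        using that T(2) by simp
    qed
    have Twy: "(T *\<^sub>v w) \<bullet>c y = T $$ (k, k) * w $ k"
    proof -
      have "(T *\<^sub>v w) \<bullet>c y = (\<Sum>i \<in> {0..<N}. (T *\<^sub>v w) $ i * cnj (y $ i))"
        using y(1) by (simp add: scalar_prod_def del: index_mult_mat_vec)
      also have "\<dots> = (\<Sum>i \<in> {k}. (T *\<^sub>v w) $ i * cnj (y $ i))"
        using y(2) Tw k by (intro sum.mono_neutral_right) (auto simp: not_less simp del: index_mult_mat_vec, metis not_less)
      finally show ?thesis
        using Tw k y(3) by (simp del: index_mult_mat_vec)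
    qed
    have c: "(W *\<^sub>v y) \<bullet>c y = w $ k"
      using wc[OF y(1)] y(2,3) by (simp add: w_def)
    have c_real: "Im (w $ k) = 0"
      using hermitian_form_real[OF W y(1)] by (simp add: c)
    have c_pos: "0 < Re (w $ k)"
    proof -
      have Ta: "mat_adjoint T \<in> carrier_mat N N"
        using T(1) by simp
      \<comment> \<open>Since \<open>W\<close> is Hermitian, the term from
        \<open>W * mat_adjoint T\<close> is the complex conjugate of the term from
        \<open>T * W\<close>; their sum is twice a real part.\<close>
      have "(W *\<^sub>v (mat_adjoint T *\<^sub>v y)) \<bullet>c y = (mat_adjoint T *\<^sub>v y) \<bullet>c w"
        using cscalar_prod_adjoint[OF W(1) _ y(1), of "mat_adjoint T *\<^sub>v y"] W(2) Ta y(1) by (simp add: w_def)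
      also have "\<dots> = y \<bullet>c (T *\<^sub>v w)"
        using cscalar_prod_adjoint[OF Ta y(1) w] by simp
      also have "\<dots> = cnj (T $$ (k, k) * w $ k)"
        using cscalar_prod_cnj[of "T *\<^sub>v w" N y] T(1) w y(1) by (simp add: Twy)
      finally have adj: "(W *\<^sub>v (mat_adjoint T *\<^sub>v y)) \<bullet>c y = cnj (T $$ (k, k) * w $ k)" .
      have "(T * W + W * mat_adjoint T + B) *\<^sub>v y = T *\<^sub>v w + W *\<^sub>v (mat_adjoint T *\<^sub>v y) + B *\<^sub>v y"
        using T(1) Ta W(1) B(1) y(1)
        by (simp add: w_def add_mult_distrib_mat_vec[of _ N N] assoc_mult_mat_vec[of _ N N _ N])
      moreover have "0\<^sub>m N N *\<^sub>v y = 0\<^sub>v N"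
        using y(1) by (intro eq_vecI) auto
      ultimately have "T *\<^sub>v w + W *\<^sub>v (mat_adjoint T *\<^sub>v y) + B *\<^sub>v y = 0\<^sub>v N"
        by (simp only: eq)
      then have "0 = (T *\<^sub>v w + W *\<^sub>v (mat_adjoint T *\<^sub>v y) + B *\<^sub>v y) \<bullet>c y"
        using y(1) by simp
      also have "\<dots> = (T *\<^sub>v w) \<bullet>c y + (W *\<^sub>v (mat_adjoint T *\<^sub>v y)) \<bullet>c y + (B *\<^sub>v y) \<bullet>c y"
        using mult_mat_vec_carrier[OF T(1) w] mult_mat_vec_carrier[OF B(1) y(1)] y(1)
          mult_mat_vec_carrier[OF W(1) mult_mat_vec_carrier[OF Ta y(1)]]
        by (simp add: add_scalar_prod_distrib[of _ N])
      finally have "0 = T $$ (k, k) * w $ k + cnj (T $$ (k, k) * w $ k) + (B *\<^sub>v y) \<bullet>c y"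
        by (simp only: adj Twy)
      then have "0 = 2 * (Re (T $$ (k, k)) * Re (w $ k)) + Re ((B *\<^sub>v y) \<bullet>c y)"
        using c_real by (simp add: complex_eq_iff mult.commute)
      moreover have "0 < Re ((B *\<^sub>v y) \<bullet>c y)"
        using B y k by (auto simp: pos_def_iff)
      ultimately have "Re (T $$ (k, k)) * Re (w $ k) < 0"
        by linarith
      then show ?thesis
        using stable[OF k] by (simp add: mult_less_0_iff)
    qed
    \<comment> \<open>Subtracting the multiple of \<open>y\<close> that clears entry
      \<open>k\<close> leaves a vector supported beyond \<open>k\<close>. There \<open>W y\<close>
      vanishes, so \<open>z\<close> and \<open>y\<close> are orthogonal for the form of
      \<open>W\<close>, and the form of \<open>x\<close> splits into a part handled by induction and
      a part handled by \<open>c_pos\<close>.\<close>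
    define z where "z = x - x $ k \<cdot>\<^sub>v y"
    have z: "z \<in> carrier_vec N" "\<forall>i < Suc k. z $ i = 0"
      using step.prems y k by (auto simp: z_def less_Suc_eq)
    have xz: "x = z + x $ k \<cdot>\<^sub>v y"
      using step.prems(1) y(1) by (intro eq_vecI) (auto simp: z_def)
    have "w \<bullet>c z = 0"
      using wc[OF z(1)] z(2) by simp
    then have yz: "(W *\<^sub>v y) \<bullet>c z = 0" "(W *\<^sub>v z) \<bullet>c y = 0"
      using hermitian_cscalar_prod_swap[OF W z(1) y(1)] by (simp_all add: w_def)
    have "(W *\<^sub>v x) \<bullet>c x = (W *\<^sub>v (z + x $ k \<cdot>\<^sub>v y)) \<bullet>c (z + x $ k \<cdot>\<^sub>v y)"
      by (simp only: xz[symmetric])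
    also have "\<dots> = (W *\<^sub>v z) \<bullet>c z + x $ k * cnj (x $ k) * w $ k"
      using W(1) z(1) y(1) c by (simp add: form_add[of _ N] form_smult[of _ N] yz)
    finally have form: "Re ((W *\<^sub>v x) \<bullet>c x) = Re ((W *\<^sub>v z) \<bullet>c z) + (cmod (x $ k))\<^sup>2 * Re (w $ k)"
      by (simp del: of_real_power flip: complex_norm_square)
    show ?case
    proof (cases "z = 0\<^sub>v N")
      case True
      then have "x $ k \<noteq> 0"
        using xz step.prems(3) y(1) by (auto simp: left_zero_vec[of _ N])
      moreover have "(W *\<^sub>v z) \<bullet>c z = 0"
        using W(1) True by (simp add: scalar_prod_right_zero[OF mult_mat_vec_carrier])
      ultimately show ?thesis
        using c_pos by (simp add: form)
    next
      case False
      then show ?thesis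
        using step.IH[OF z] c_pos form by (simp add: add_pos_nonneg)
    qed
  qed
  show ?thesis
    using pos[of 0] W by (simp add: pos_def_iff)
qed

section \<open>Jordan matrices, Sylvester equations and rank\<close>

lemma jordan_matrix_append:
  "jordan_matrix (xs @ ys) = four_block_mat (jordan_matrix xs)
     (0\<^sub>m (total_size xs) (total_size ys)) (0\<^sub>m (total_size ys) (total_size xs)) (jordan_matrix ys)"
  using jordan_matrix_dim[of xs] jordan_matrix_dim[of ys]
  by (simp add: jordan_matrix_def diag_block_mat_append Let_def total_size_def)

text \<open>Carries the sign conditions on the eigenvalues in a block list over to the diagonal
  entries of the Jordan matrix.\<close>

lemma jordan_matrix_diag:
  "i < total_size bs \<Longrightarrow> \<exists>k. (k, jordan_matrix bs $$ (i, i)) \<in> set bs"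
proof (induction bs arbitrary: i)
  case Nil
  then show ?case by (simp add: total_size_def)
next
  case (Cons b bs)
  obtain k l where b: "b = (k, l)" by force
  show ?case
  proof (cases "i < k")
    case True
    then show ?thesis
      by (auto simp: b jordan_matrix_Cons jordan_block_def)
  next
    case False
    have "i - k < total_size bs"
      using Cons.prems False by (simp add: b total_size_def)
    from Cons.IH[OF this] show ?thesis
      using Cons.prems False by (auto simp: b jordan_matrix_Cons total_size_def)
  qed
qed

section \<open>Entrywise conjugation, Sylvester equations and full column rank\<close>

lemma map_mat_cnj_mult:
  assumes "A \<in> carrier_mat nr n" "B \<in> carrier_mat n nc"
  shows "map_mat cnj (A * B) = map_mat cnj A * map_mat cnj B"
  using assms by (intro eq_matI) (simp_all add: scalar_prod_def)

text \<open>Compare the entries at \<open>(i, j)\<close> in \<open>X * J = C * X\<close>, by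
  induction on \<open>(N - i) + j\<close>. On the left, the terms with index below \<open>N\<close>
  drop out by the block structure of \<open>J\<close>, those from \<open>N\<close> up to
  \<open>j\<close> by induction; on the right, the terms with index above \<open>i\<close> drop out
  by induction. What remains is \<open>X $$ (i, j)\<close> times two different diagonal
  entries.\<close>

lemma sylvester_block_zero:
  fixes C J X :: "complex mat"
  assumes C: "C \<in> carrier_mat N N" "\<And>i j. i < N \<Longrightarrow> j < i \<Longrightarrow> C $$ (i, j) = 0"
    and J: "J \<in> carrier_mat n n" "\<And>i j. i < n \<Longrightarrow> j < i \<Longrightarrow> J $$ (i, j) = 0"
      "\<And>i j. i < N \<Longrightarrow> N \<le> j \<Longrightarrow> j < n \<Longrightarrow> J $$ (i, j) = 0"
    and ne: "\<And>i j. i < N \<Longrightarrow> N \<le> j \<Longrightarrow> j < n \<Longrightarrow> C $$ (i, i) \<noteq> J $$ (j, j)"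
    and X: "X \<in> carrier_mat N n" "X * J = C * X"
    and ij: "i < N" "N \<le> j" "j < n"
  shows "X $$ (i, j) = 0"
  using ij
proof (induction "(N - i) + j" arbitrary: i j rule: less_induct)
  case less
  have "(X * J) $$ (i, j) = (\<Sum>k \<in> {0..<n}. X $$ (i, k) * J $$ (k, j))"
    using less.prems X(1) J(1) by (simp add: scalar_prod_def)
  also have "\<dots> = (\<Sum>k \<in> {j}. X $$ (i, k) * J $$ (k, j))"
  proof (intro sum.mono_neutral_right ballI)
    fix k assume k: "k \<in> {0..<n} - {j}"
    then consider "k < N" | "N \<le> k" "k < j" | "j < k" "k < n"
      by fastforce
    then show "X $$ (i, k) * J $$ (k, j) = 0"
    proof cases
      case 1
      then show ?thesis using J(3) less.prems by simp
    next
      case 2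
      then show ?thesis using less.hyps[of i k] less.prems by simp
    next
      case 3
      then show ?thesis using J(2) by simp
    qed
  qed (use less.prems in auto)
  finally have XJ: "(X * J) $$ (i, j) = X $$ (i, j) * J $$ (j, j)"
    by simp
  have "(C * X) $$ (i, j) = (\<Sum>k \<in> {0..<N}. C $$ (i, k) * X $$ (k, j))"
    using less.prems X(1) C(1) by (simp add: scalar_prod_def)
  also have "\<dots> = (\<Sum>k \<in> {i}. C $$ (i, k) * X $$ (k, j))"
  proof (intro sum.mono_neutral_right ballI)
    fix k assume k: "k \<in> {0..<N} - {i}"
    then consider "k < i" | "i < k" "k < N"
      by fastforce
    then show "C $$ (i, k) * X $$ (k, j) = 0"
    proof cases
      case 1
      then show ?thesis using C(2) less.prems by simp
    next
      case 2
      then show ?thesis using less.hyps[of k j] less.prems by simp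
    qed
  qed (use less.prems in auto)
  finally have "(C * X) $$ (i, j) = C $$ (i, i) * X $$ (i, j)"
    by simp
  then have "X $$ (i, j) * J $$ (j, j) = C $$ (i, i) * X $$ (i, j)"
    using XJ X(2) by metis
  then show ?case
    using ne[OF less.prems] by (metis mult.commute mult_cancel_right)
qed

text \<open>Linear independence refers to the set of columns, so repeated columns must be excluded
  first: a maximal independent set of columns has \<open>nc\<close> elements, which leaves no room
  for repetitions.\<close>

lemma (in vec_space) full_rank_mult_vec_inj:
  assumes A: "A \<in> carrier_mat n nc" "rank A = nc"
    and v: "v \<in> carrier_vec nc" "A *\<^sub>v v = 0\<^sub>v n"
  shows "v = 0\<^sub>v nc"
proof -
  obtain S where S: "maximal S (\<lambda>T. T \<subseteq> set (cols A) \<and> lin_indpt T)"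
    using maximal_exists_superset[of "set (cols A)" "\<lambda>T. T \<subseteq> set (cols A) \<and> lin_indpt T" "{}"]
      finite_lin_indpt2[of "{}"] by auto
  then have "card S \<le> card (set (cols A))"
    by (simp add: card_mono maximal_def)
  then have "length (cols A) \<le> card (set (cols A))"
    using rank_card_indpt[OF A(1) S] A by simp
  then have "distinct (cols A)"
    using card_length[of "cols A"] by (intro card_distinct) simp
  then show ?thesis
    using full_rank_lin_indpt[OF A] lin_depI[OF A(1) v(1) _ v(2)] by blast
qed

section \<open>Compactness of the simplex\<close>

text \<open>Bolzano-Weierstrass, one coordinate at a time: a monotone subsequence of the next
  coordinate converges because it is bounded, and the limits already obtained survive the
  refinement.\<close>

lemma convergent_subsequence_coordinates:
  fixes f :: "nat \<Rightarrow> nat \<Rightarrow> real"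
  assumes "\<And>i k. i < n \<Longrightarrow> \<bar>f k i\<bar> \<le> C"
  shows "\<exists>r l. strict_mono (r :: nat \<Rightarrow> nat) \<and> (\<forall>i < n. (\<lambda>k. f (r k) i) \<longlonglongrightarrow> l i)"
  using assms
proof (induction n)
  case 0
  then show ?case
    using strict_mono_id by blast
next
  case (Suc n)
  then obtain r l where r: "strict_mono (r :: nat \<Rightarrow> nat)" "\<And>i. i < n \<Longrightarrow> (\<lambda>k. f (r k) i) \<longlonglongrightarrow> l i"
    by (metis less_Suc_eq)
  obtain s where s: "strict_mono (s :: nat \<Rightarrow> nat)" "monoseq (\<lambda>k. f (r (s k)) n)"
    using seq_monosub[of "\<lambda>k. f (r k) n"] by blast
  have "Bseq (\<lambda>k. f (r (s k)) n)"
    using Suc.prems by (intro BseqI'[of _ C]) simp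
  then obtain a where a: "(\<lambda>k. f (r (s k)) n) \<longlonglongrightarrow> a"
    using Bseq_monoseq_convergent[OF _ s(2)] by (auto simp: convergent_def)
  have "strict_mono (r \<circ> s)"
    using r(1) s(1) by (rule strict_mono_o)
  moreover have "(\<lambda>k. f ((r \<circ> s) k) i) \<longlonglongrightarrow> (l(n := a)) i" if "i < Suc n" for i
    using that a LIMSEQ_subseq_LIMSEQ[OF r(2) s(1), of i] by (auto simp: o_def less_Suc_eq)
  ultimately show ?case by blast
qed

lemma prob_simplex_compact:
  assumes p: "\<And>k. p k \<in> prob_simplex n"
  obtains r l where "strict_mono (r :: nat \<Rightarrow> nat)" "l \<in> prob_simplex n"
    "\<And>i. i < n \<Longrightarrow> (\<lambda>k. p (r k) $ i) \<longlonglongrightarrow> l $ i"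
proof -
  have nonneg: "0 \<le> p k $ i" if "i < n" for i k
    using p[of k] that by (simp add: prob_simplex_def)
  have sum1: "(\<Sum>i<n. p k $ i) = 1" for k
    using p[of k] by (simp add: prob_simplex_def)
  have "\<bar>p k $ i\<bar> \<le> 1" if "i < n" for i k
    using member_le_sum[of i "{..<n}" "\<lambda>i. p k $ i"] nonneg sum1[of k] that by simp
  from convergent_subsequence_coordinates[of n "\<lambda>k i. p k $ i", OF this]
  obtain r l where r: "strict_mono (r :: nat \<Rightarrow> nat)" "\<And>i. i < n \<Longrightarrow> (\<lambda>k. p (r k) $ i) \<longlonglongrightarrow> l i"
    by auto
  have "0 \<le> l i" if "i < n" for i
    using LIMSEQ_le_const[OF r(2)[OF that]] nonneg[OF that] by blast
  moreover have "(\<lambda>k. \<Sum>i<n. p (r k) $ i) \<longlonglongrightarrow> (\<Sum>i<n. l i)"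
    using r(2) by (intro tendsto_sum) auto
  then have "(\<Sum>i<n. l i) = 1"
    using sum1 by (simp add: LIMSEQ_const_iff)
  ultimately have "vec n l \<in> prob_simplex n"
    by (simp add: prob_simplex_def)
  with r show ?thesis
    by (intro that) auto
qed

section \<open>The matrices of the AECS problem\<close>

locale jordan_decomposition =
  fixes A :: "real mat" and Q :: "complex mat" and bm bz bp :: blocks and n :: nat
  assumes A: "A \<in> carrier_mat n n"
    and decomposition: "ordered_jordan_decomposition (map_mat complex_of_real A) Q bm bz bp"
begin

abbreviation "N \<equiv> total_size bm"
abbreviation "Jm \<equiv> jordan_matrix bm"
abbreviation "J \<equiv> jordan_matrix (bm @ bz @ bp)"
abbreviation "R \<equiv> mat_inv Q"
abbreviation "Ac \<equiv> map_mat complex_of_real A"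

text \<open>The columns of this matrix are the vectors \<open>q_minus Q bm i\<close>.\<close>

definition P :: "complex mat" where "P = mat N n (\<lambda>(a, i). R $$ (a, i))"

text \<open>A right inverse of \<open>P\<close>; it witnesses that the columns of \<open>P\<close>
  span the whole space.\<close>

definition E :: "complex mat" where "E = mat n N (\<lambda>(i, a). Q $$ (i, a))"

lemma Q_carrier: "Q \<in> carrier_mat n n" and dim_Q [simp]: "dim_row Q = n"
  and R_inverse: "R \<in> carrier_mat n n" "Q * R = 1\<^sub>m n" "R * Q = 1\<^sub>m n"
  and R_A_Q: "R * Ac * Q = J"
proof -
  show Q_carrier: "Q \<in> carrier_mat n n"
    using A decomposition by (simp add: ordered_jordan_decomposition_def)
  then show "dim_row Q = n" by simp
  show "R \<in> carrier_mat n n" "Q * R = 1\<^sub>m n" "R * Q = 1\<^sub>m n"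
    using mat_inv_invertible[OF Q_carrier] decomposition by (simp_all add: ordered_jordan_decomposition_def)
  show "R * Ac * Q = J"
    using decomposition by (simp add: ordered_jordan_decomposition_def)
qed

lemma J_carrier: "J \<in> carrier_mat n n"
  using R_A_Q Q_carrier R_inverse(1) A by (metis mult_carrier_mat map_carrier_mat)

lemma Jm_carrier: "Jm \<in> carrier_mat N N"
  by (simp add: total_size_def)

lemma block_sizes: "total_size bm + (total_size bz + total_size bp) = n"
  using carrier_matD(1)[OF J_carrier] by (simp add: total_size_def)

lemma N_le: "N \<le> n"
  using block_sizes by simp

lemma J_upper: "i < n \<Longrightarrow> j < i \<Longrightarrow> J $$ (i, j) = 0"
  using block_sizes by (intro jordan_matrix_upper_triangular) (auto simp: total_size_def)

lemma Jm_upper: "i < N \<Longrightarrow> j < i \<Longrightarrow> Jm $$ (i, j) = 0"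
  by (intro jordan_matrix_upper_triangular) (auto simp: total_size_def)

lemma J_index:
  assumes "i < N" "j < n"
  shows "J $$ (i, j) = (if j < N then Jm $$ (i, j) else 0)"
proof -
  have "dim_row Jm = N" "dim_col Jm = N" "dim_row (jordan_matrix (bz @ bp)) = n - N"
    "dim_col (jordan_matrix (bz @ bp)) = n - N"
    using block_sizes by (auto simp: total_size_def)
  with assms show ?thesis
    by (simp add: jordan_matrix_append[of bm] total_size_def)
qed

lemma Jm_stable:
  assumes "i < N"
  shows "Re (Jm $$ (i, i)) < 0"
  using jordan_matrix_diag[OF assms] decomposition by (auto simp: ordered_jordan_decomposition_def)

lemma J_diag_nonneg:
  assumes "N \<le> j" "j < n"
  shows "0 \<le> Re (J $$ (j, j))"
proof -
  have "dim_row Jm = N" "dim_col Jm = N" "dim_row (jordan_matrix (bz @ bp)) = n - N"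
    "dim_col (jordan_matrix (bz @ bp)) = n - N"
    using block_sizes by (auto simp: total_size_def)
  then have "J $$ (j, j) = jordan_matrix (bz @ bp) $$ (j - N, j - N)"
    using assms by (simp add: jordan_matrix_append[of bm])
  moreover have "j - N < total_size (bz @ bp)"
    using assms block_sizes by (auto simp: total_size_def)
  then obtain k where "(k, jordan_matrix (bz @ bp) $$ (j - N, j - N)) \<in> set (bz @ bp)"
    using jordan_matrix_diag by blast
  ultimately show ?thesis
    using decomposition by (fastforce simp: ordered_jordan_decomposition_def)
qed

section \<open>The stable rows of the inverse of \<open>Q\<close> and their conjugates\<close>

lemma P_carrier: "P \<in> carrier_mat N n" and E_carrier: "E \<in> carrier_mat n N"
  by (simp_all add: P_def E_def)

lemma P_index: "a < N \<Longrightarrow> i < n \<Longrightarrow> P $$ (a, i) = R $$ (a, i)"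
  by (simp add: P_def)

lemma P_mult_index:
  assumes "X \<in> carrier_mat n m" "a < N" "i < m"
  shows "(P * X) $$ (a, i) = (R * X) $$ (a, i)"
  using assms P_carrier R_inverse(1) N_le by (auto simp: scalar_prod_def P_index intro!: sum.cong)

lemma P_E: "P * E = 1\<^sub>m N"
proof (rule eq_matI)
  fix a b assume "a < dim_row (1\<^sub>m N :: complex mat)" "b < dim_col (1\<^sub>m N :: complex mat)"
  then have ab: "a < N" "b < N" "a < n" "b < n"
    using N_le by auto
  have "(P * E) $$ (a, b) = (R * Q) $$ (a, b)"
    using ab Q_carrier R_inverse(1) E_carrier P_carrier by (auto simp: scalar_prod_def P_index E_def intro!: sum.cong)
  then show "(P * E) $$ (a, b) = 1\<^sub>m N $$ (a, b)"
    using ab by (simp add: R_inverse(3))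
qed (use P_carrier E_carrier in auto)

lemma q_minus_eq:
  assumes "i < n"
  shows "q_minus Q bm i = col P i"
proof (rule eq_vecI)
  fix a assume "a < dim_vec (col P i)"
  then have "a < N" using P_carrier by simp
  moreover from this have "a < n" using N_le by simp
  ultimately show "q_minus Q bm i $ a = col P i $ a"
    using assms P_carrier R_inverse(1) by (simp add: q_minus_def vec_first_def P_index)
qed (use P_carrier in \<open>simp add: q_minus_def\<close>)

text \<open>These are the first \<open>N\<close> rows of \<open>J * R = R * Ac\<close>: there
  \<open>J\<close> consists of \<open>Jm\<close> followed by zeros.\<close>

lemma P_intertwines: "P * Ac = Jm * P"
proof -
  have "J * R = R * Ac * (Q * R)"
    using R_A_Q R_inverse(1) Q_carrier A by (simp add: assoc_mult_mat[of _ n n _ n _ n] flip: R_A_Q)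
  then have JR: "J * R = R * Ac"
    using R_inverse(1) A by (simp add: R_inverse(2) right_mult_one_mat[of _ n n])
  show ?thesis
  proof (rule eq_matI)
    fix a i assume "a < dim_row (Jm * P)" "i < dim_col (Jm * P)"
    then have ai: "a < N" "i < n" "a < n"
      using Jm_carrier P_carrier N_le by (auto simp del: jordan_matrix_dim jordan_matrix_carrier)
    have "(P * Ac) $$ (a, i) = (J * R) $$ (a, i)"
      using A ai by (simp add: JR P_mult_index[of _ n])
    also have "\<dots> = (\<Sum>k \<in> {0..<n}. J $$ (a, k) * R $$ (k, i))"
      using ai J_carrier R_inverse(1) by (simp add: scalar_prod_def del: jordan_matrix_dim jordan_matrix_carrier)
    also have "\<dots> = (\<Sum>k \<in> {0..<N}. J $$ (a, k) * R $$ (k, i))"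
      using ai N_le by (intro sum.mono_neutral_right) (auto simp: J_index)
    also have "\<dots> = (\<Sum>k \<in> {0..<N}. Jm $$ (a, k) * P $$ (k, i))"
      using ai N_le by (intro sum.cong) (auto simp: J_index P_index)
    also have "\<dots> = (Jm * P) $$ (a, i)"
      using ai P_carrier Jm_carrier by (simp add: scalar_prod_def del: jordan_matrix_dim jordan_matrix_carrier)
    finally show "(P * Ac) $$ (a, i) = (Jm * P) $$ (a, i)" .
  qed (use P_carrier A Jm_carrier in \<open>auto simp del: jordan_matrix_dim jordan_matrix_carrier\<close>)
qed

text \<open>The conjugate of \<open>P\<close> intertwines \<open>Ac\<close> with the conjugate of
  \<open>Jm\<close>, so \<open>X\<close> solves a Sylvester equation between that matrix and
  \<open>J\<close>. Conjugation keeps real parts, hence the diagonal of the conjugated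
  \<open>Jm\<close> avoids the diagonal entries of \<open>J\<close> beyond \<open>N\<close>, and
  \<open>X\<close> vanishes in those columns. Multiplying back by \<open>R\<close> then involves
  only the rows of \<open>R\<close> that form \<open>P\<close>.\<close>

lemma cnj_P:
  obtains T where "T \<in> carrier_mat N N" "map_mat cnj P = T * P"
proof -
  define X where "X = map_mat cnj P * Q"
  have cP: "map_mat cnj P \<in> carrier_mat N n" and cJ: "map_mat cnj Jm \<in> carrier_mat N N"
    and X: "X \<in> carrier_mat N n" and Ac: "Ac \<in> carrier_mat n n"
    using P_carrier Jm_carrier Q_carrier A by (auto simp: X_def)
  \<comment> \<open>This is where it matters that \<open>A\<close> is real.\<close>
  have "map_mat cnj Ac = Ac"
    by (intro eq_matI) auto
  then have inter: "map_mat cnj P * Ac = map_mat cnj Jm * map_mat cnj P"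
    using map_mat_cnj_mult[OF P_carrier Ac] map_mat_cnj_mult[OF Jm_carrier P_carrier] by (simp add: P_intertwines)
  have XR: "X * R = map_mat cnj P"
    using cP Q_carrier R_inverse by (simp add: X_def assoc_mult_mat[of _ N n _ n _ n])
  have "X * J = X * R * (Ac * Q)"
    using X R_inverse(1) Ac Q_carrier by (simp add: assoc_mult_mat[of _ N n _ n _ n] assoc_mult_mat[of _ n n _ n _ n] flip: R_A_Q)
  also have "\<dots> = map_mat cnj P * Ac * Q"
    using cP Ac Q_carrier by (simp add: XR assoc_mult_mat[of _ N n _ n _ n])
  also have "\<dots> = map_mat cnj Jm * X"
    using cP cJ Q_carrier by (simp add: inter X_def assoc_mult_mat[of _ N N _ n _ n])
  finally have XJ: "X * J = map_mat cnj Jm * X" .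
  have X0: "X $$ (i, j) = 0" if "i < N" "N \<le> j" "j < n" for i j
  proof (rule sylvester_block_zero[OF cJ _ J_carrier J_upper _ _ X XJ that])
    fix i j assume ij: "i < N" "N \<le> j" "j < n"
    show "map_mat cnj Jm $$ (i, i) \<noteq> J $$ (j, j)"
      using Jm_stable[OF ij(1)] J_diag_nonneg[OF ij(2,3)] ij Jm_carrier
      by (auto dest!: arg_cong[of _ _ Re] simp del: jordan_matrix_dim jordan_matrix_carrier)
  qed (use Jm_carrier Jm_upper in \<open>auto simp: J_index simp del: jordan_matrix_dim jordan_matrix_carrier\<close>)
  define T where "T = mat N N (\<lambda>(a, b). X $$ (a, b))"
  have T: "T \<in> carrier_mat N N"
    by (simp add: T_def)
  have "X * R = T * P"
  proof (rule eq_matI)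
    fix a i assume "a < dim_row (T * P)" "i < dim_col (T * P)"
    then have ai: "a < N" "i < n"
      using T P_carrier by auto
    have "(X * R) $$ (a, i) = (\<Sum>k \<in> {0..<n}. X $$ (a, k) * R $$ (k, i))"
      using ai X R_inverse(1) by (simp add: scalar_prod_def)
    also have "\<dots> = (\<Sum>k \<in> {0..<N}. X $$ (a, k) * R $$ (k, i))"
      using ai N_le X0 by (intro sum.mono_neutral_right) auto
    also have "\<dots> = (\<Sum>k \<in> {0..<N}. T $$ (a, k) * P $$ (k, i))"
      using ai by (intro sum.cong) (auto simp: T_def P_index)
    also have "\<dots> = (T * P) $$ (a, i)"
      using ai P_carrier T by (simp add: scalar_prod_def)
    finally show "(X * R) $$ (a, i) = (T * P) $$ (a, i)" .
  qed (use X R_inverse(1) T P_carrier in auto)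
  with T XR show ?thesis
    using that by simp
qed

abbreviation "q i \<equiv> col P i"
abbreviation "W \<equiv> W_minus Q bm"
abbreviation "B \<equiv> B_minus Q bm"

lemma q_carrier [simp]: "i < n \<Longrightarrow> q i \<in> carrier_vec N"
  using P_carrier by auto

text \<open>By \<open>cnj_P\<close>, the conjugated factor can be exchanged for an unconjugated one
  through a fixed linear map, so a vanishing combination of the matrices \<open>q i\<close> times
  its adjoint gives a vanishing combination of the matrices \<open>q i\<close> times its transpose.
  The entries of the latter are those of the Kronecker products in \<open>M_AECS\<close>, whose
  columns are independent.\<close>

lemma rank_one_sums_injective:
  fixes c :: "nat \<Rightarrow> real"
  assumes rank: "vec_space.rank (N\<^sup>2) (M_AECS Q bm) = n"
    and zero: "\<And>a b. a < N \<Longrightarrow> b < N \<Longrightarrow> (\<Sum>i<n. c i * P $$ (a, i) * cnj (P $$ (b, i))) = 0"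
    and i: "i < n"
  shows "c i = 0"
proof -
  obtain T where T: "T \<in> carrier_mat N N" "map_mat cnj P = T * P"
    by (rule cnj_P)
  have sum0: "(\<Sum>i<n. c i * P $$ (a, i) * P $$ (b, i)) = 0" if ab: "a < N" "b < N" for a b
  proof -
    have "P $$ (b, i) = (\<Sum>k<N. cnj (T $$ (b, k)) * cnj (P $$ (k, i)))" if "i < n" for i
    proof -
      have "map_mat cnj P $$ (b, i) = (\<Sum>k<N. T $$ (b, k) * P $$ (k, i))"
        using T(1) P_carrier ab that by (simp add: T(2) scalar_prod_def atLeast0LessThan)
      then have "cnj (P $$ (b, i)) = (\<Sum>k<N. T $$ (b, k) * P $$ (k, i))"
        using P_carrier ab that by simp
      then have "cnj (cnj (P $$ (b, i))) = cnj (\<Sum>k<N. T $$ (b, k) * P $$ (k, i))"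
        by (rule arg_cong)
      then show ?thesis by simp
    qed
    then have "(\<Sum>i<n. c i * P $$ (a, i) * P $$ (b, i)) =
        (\<Sum>i<n. \<Sum>k<N. c i * P $$ (a, i) * (cnj (T $$ (b, k)) * cnj (P $$ (k, i))))"
      by (simp add: sum_distrib_left)
    also have "\<dots> = (\<Sum>k<N. cnj (T $$ (b, k)) * (\<Sum>i<n. c i * P $$ (a, i) * cnj (P $$ (k, i))))"
      by (subst sum.swap) (simp add: sum_distrib_left mult_ac)
    also have "\<dots> = 0"
      using zero ab by simp
    finally show ?thesis .
  qed
  define v where "v = vec n (\<lambda>i. complex_of_real (c i))"
  have M_eq: "M_AECS Q bm = mat_of_cols (N\<^sup>2) (map (\<lambda>i. vec_kron (q i) (q i)) [0..<n])"
    by (auto simp: M_AECS_def q_minus_eq intro!: arg_cong[of _ _ "mat_of_cols (N\<^sup>2)"])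
  have M: "M_AECS Q bm \<in> carrier_mat (N\<^sup>2) n"
    by (intro carrier_matI) (simp_all add: M_eq)
  have "M_AECS Q bm *\<^sub>v v = 0\<^sub>v (N\<^sup>2)"
  proof (rule eq_vecI)
    fix r assume "r < dim_vec (0\<^sub>v (N\<^sup>2) :: complex vec)"
    then have r: "r < N * N"
      by (simp add: power2_eq_square)
    \<comment> \<open>Position \<open>r\<close> of a Kronecker product encodes the pair of indices
      \<open>r div N\<close> and \<open>r mod N\<close>.\<close>
    then have rN: "r div N < N" "r mod N < N"
      by (simp_all add: less_mult_imp_div_less) (metis mod_less_divisor mult_0_right not_gr_zero not_less_zero)
    have "(M_AECS Q bm *\<^sub>v v) $ r = (\<Sum>i<n. M_AECS Q bm $$ (r, i) * c i)"
      using M r by (simp add: scalar_prod_def v_def atLeast0LessThan power2_eq_square)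
    also have "\<dots> = (\<Sum>i<n. c i * P $$ (r div N, i) * P $$ (r mod N, i))"
      using r rN P_carrier by (intro sum.cong)
        (auto simp: M_eq mat_of_cols_index vec_kron_def power2_eq_square)
    finally show "(M_AECS Q bm *\<^sub>v v) $ r = 0\<^sub>v (N\<^sup>2) $ r"
      using sum0[OF rN] r by (simp add: power2_eq_square)
  qed (use M in simp)
  then have "v = 0\<^sub>v n"
    using vec_space.full_rank_mult_vec_inj[OF M rank] by (simp add: v_def)
  then have "v $ i = 0"
    using i by simp
  then show ?thesis
    using i by (simp add: v_def)
qed

section \<open>The maps from \<open>p\<close> to \<open>B p\<close> and \<open>W p\<close>, and a
  feasible point\<close>

lemma B_carrier: "B p \<in> carrier_mat N N"
  by (simp add: B_minus_def Let_def)

lemma B_index: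
  assumes "a < N" "b < N"
  shows "B p $$ (a, b) = (\<Sum>i<n. p $ i * P $$ (a, i) * cnj (P $$ (b, i)))"
proof -
  have RD: "R * mat_diag n (\<lambda>i. complex_of_real (p $ i)) = mat n n (\<lambda>(a, i). R $$ (a, i) * p $ i)"
    using R_inverse(1) by (simp add: mat_diag_mult_right[of _ n n])
  have "B p $$ (a, b) = (R * mat_diag n (\<lambda>i. complex_of_real (p $ i)) * mat_adjoint R) $$ (a, b)"
    using assms by (simp add: B_minus_def Let_def)
  also have "\<dots> = (\<Sum>i<n. R $$ (a, i) * p $ i * cnj (R $$ (b, i)))"
    using assms N_le R_inverse(1) by (simp add: RD scalar_prod_def atLeast0LessThan)
  also have "\<dots> = (\<Sum>i<n. p $ i * P $$ (a, i) * cnj (P $$ (b, i)))"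
    using assms by (intro sum.cong) (auto simp: P_index)
  finally show ?thesis .
qed

lemma W_ex1: "C \<in> carrier_mat N N \<Longrightarrow>
    \<exists>!W. W \<in> carrier_mat N N \<and> Jm * W + W * mat_adjoint Jm + C = 0\<^sub>m N N"
proof (rule lyapunov_ex1[OF Jm_carrier Jm_upper])
  fix i j assume "i < N" "j < N"
  then have "Re (Jm $$ (i, i) + cnj (Jm $$ (j, j))) < 0"
    using Jm_stable by (simp add: add_neg_neg)
  then show "Jm $$ (i, i) + cnj (Jm $$ (j, j)) \<noteq> 0"
    by (metis less_irrefl zero_complex.simps(1))
qed

lemma W_solves: "W p \<in> carrier_mat N N" "Jm * W p + W p * mat_adjoint Jm + B p = 0\<^sub>m N N"
  using theI'[OF W_ex1[OF B_carrier[of p]]] by (simp_all add: W_minus_def)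

lemma W_dim [simp]: "dim_row (W p) = N" "dim_col (W p) = N"
  using W_solves(1)[of p] by auto

lemma W_unique:
  assumes "V \<in> carrier_mat N N" "Jm * V + V * mat_adjoint Jm + B p = 0\<^sub>m N N"
  shows "W p = V"
  using W_ex1[OF B_carrier[of p]] W_solves[of p] assms by blast

lemma B_hermitian: "mat_adjoint (B p) = B p"
  using B_carrier[of p] by (intro eq_matI) (auto simp: B_index mult_ac)

text \<open>Taking adjoints turns the equation for \<open>W p\<close> into the same equation for its
  adjoint, as \<open>B p\<close> is Hermitian; uniqueness does the rest.\<close>

lemma W_hermitian: "mat_adjoint (W p) = W p"
proof (rule W_unique[symmetric])
  have Ja: "mat_adjoint Jm \<in> carrier_mat N N" and Wa: "mat_adjoint (W p) \<in> carrier_mat N N"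
    using Jm_carrier W_solves(1) by (auto intro: mat_adjoint_carrier)
  show "mat_adjoint (W p) \<in> carrier_mat N N"
    by (rule Wa)
  have c: "Jm * W p \<in> carrier_mat N N" "W p * mat_adjoint Jm \<in> carrier_mat N N"
    "Jm * mat_adjoint (W p) \<in> carrier_mat N N" "mat_adjoint (W p) * mat_adjoint Jm \<in> carrier_mat N N"
    using Jm_carrier W_solves(1)[of p] Ja Wa by (blast intro: mult_carrier_mat)+
  have "mat_adjoint (Jm * W p + W p * mat_adjoint Jm + B p) =
      mat_adjoint (W p) * mat_adjoint Jm + Jm * mat_adjoint (W p) + B p"
    using c B_carrier[of p] Jm_carrier W_solves(1)[of p] Ja
    by (simp add: mat_adjoint_add[of _ N N] mat_adjoint_mult[of _ N N _ N] B_hermitian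
        del: jordan_matrix_dim jordan_matrix_carrier)
  moreover have "mat_adjoint (0\<^sub>m N N :: complex mat) = 0\<^sub>m N N"
    by (intro eq_matI) auto
  ultimately show "Jm * mat_adjoint (W p) + mat_adjoint (W p) * mat_adjoint Jm + B p = 0\<^sub>m N N"
    using c by (simp add: W_solves(2) comm_add_mat[of _ N N])
qed

text \<open>The combination of the solutions for the unit vectors solves the equation for
  \<open>B p\<close>, so uniqueness applies. Limits and midpoints in \<open>p\<close> thereby reduce
  to finite sums.\<close>

lemma W_linear:
  assumes "a < N" "b < N"
  shows "W p $$ (a, b) = (\<Sum>i<n. p $ i * W (unit_vec n i) $$ (a, b))"
proof -
  define V where "V = mat N N (\<lambda>(a, b). \<Sum>i<n. complex_of_real (p $ i) * W (unit_vec n i) $$ (a, b))"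
  have V: "V \<in> carrier_mat N N"
    by (simp add: V_def)
  have Ja: "mat_adjoint Jm \<in> carrier_mat N N"
    using Jm_carrier by (rule mat_adjoint_carrier)
  have "W p = V"
  proof (rule W_unique[OF V], rule eq_matI)
    fix a b assume "a < dim_row (0\<^sub>m N N)" "b < dim_col (0\<^sub>m N N)"
    then have ab: "a < N" "b < N" by auto
    have "(Jm * V) $$ (a, b) = (\<Sum>k<N. \<Sum>i<n. Jm $$ (a, k) * (p $ i * W (unit_vec n i) $$ (k, b)))"
      using ab V Jm_carrier by (simp add: scalar_prod_def atLeast0LessThan V_def sum_distrib_left
          del: jordan_matrix_dim jordan_matrix_carrier)
    also have "\<dots> = (\<Sum>i<n. p $ i * (Jm * W (unit_vec n i)) $$ (a, b))"
      using ab Jm_carrier W_solves(1)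
      by (subst sum.swap) (simp add: scalar_prod_def atLeast0LessThan sum_distrib_left mult_ac
          del: jordan_matrix_dim jordan_matrix_carrier)
    finally have l: "(Jm * V) $$ (a, b) = (\<Sum>i<n. p $ i * (Jm * W (unit_vec n i)) $$ (a, b))" .
    have "(V * mat_adjoint Jm) $$ (a, b) =
        (\<Sum>k<N. \<Sum>i<n. p $ i * W (unit_vec n i) $$ (a, k) * mat_adjoint Jm $$ (k, b))"
      using ab V Ja by (simp add: scalar_prod_def atLeast0LessThan V_def sum_distrib_right
          del: jordan_matrix_dim jordan_matrix_carrier mat_adjoint_index mat_adjoint_dim)
    also have "\<dots> = (\<Sum>i<n. p $ i * (W (unit_vec n i) * mat_adjoint Jm) $$ (a, b))"
      using ab Ja W_solves(1)
      by (subst sum.swap) (simp add: scalar_prod_def atLeast0LessThan sum_distrib_left mult_ac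
          del: jordan_matrix_dim jordan_matrix_carrier mat_adjoint_index mat_adjoint_dim)
    finally have r: "(V * mat_adjoint Jm) $$ (a, b) = (\<Sum>i<n. p $ i * (W (unit_vec n i) * mat_adjoint Jm) $$ (a, b))" .
    have "B p $$ (a, b) = (\<Sum>i<n. p $ i * B (unit_vec n i) $$ (a, b))"
    proof -
      have "B (unit_vec n i) $$ (a, b) = P $$ (a, i) * cnj (P $$ (b, i))" if "i < n" for i
      proof -
        have "B (unit_vec n i) $$ (a, b) = (\<Sum>k<n. if k = i then P $$ (a, k) * cnj (P $$ (b, k)) else 0)"
          unfolding B_index[OF ab] by (intro sum.cong refl) (use that in auto)
        then show ?thesis
          using that by simp
      qed
      then show ?thesis
        by (simp add: B_index[OF ab] mult_ac)
    qed
    with l r have "(Jm * V) $$ (a, b) + (V * mat_adjoint Jm) $$ (a, b) + B p $$ (a, b) =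
      (\<Sum>i<n. p $ i * ((Jm * W (unit_vec n i)) $$ (a, b) + (W (unit_vec n i) * mat_adjoint Jm) $$ (a, b)
         + B (unit_vec n i) $$ (a, b)))"
      by (simp only: sum.distrib distrib_left)
    also have "\<dots> = 0"
    proof (intro sum.neutral ballI)
      fix i
      have "(Jm * W (unit_vec n i) + W (unit_vec n i) * mat_adjoint Jm + B (unit_vec n i)) $$ (a, b) = 0"
        using ab by (simp add: W_solves(2))
      then have "(Jm * W (unit_vec n i)) $$ (a, b) + (W (unit_vec n i) * mat_adjoint Jm) $$ (a, b)
          + B (unit_vec n i) $$ (a, b) = 0"
        using ab Jm_carrier Ja W_solves(1)[of "unit_vec n i"] B_carrier[of "unit_vec n i"]
        by (simp del: index_mult_mat(1) jordan_matrix_dim jordan_matrix_carrier mat_adjoint_dim)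
      then show "p $ i * ((Jm * W (unit_vec n i)) $$ (a, b) + (W (unit_vec n i) * mat_adjoint Jm) $$ (a, b)
         + B (unit_vec n i) $$ (a, b)) = 0"
        by simp
    qed
    finally show "(Jm * V + V * mat_adjoint Jm + B p) $$ (a, b) = 0\<^sub>m N N $$ (a, b)"
      using ab Jm_carrier Ja V B_carrier[of p]
      by (simp del: index_mult_mat(1) jordan_matrix_dim jordan_matrix_carrier mat_adjoint_carrier)
  qed (use Jm_carrier Ja V B_carrier[of p] in \<open>auto simp del: jordan_matrix_dim jordan_matrix_carrier mat_adjoint_dim\<close>)
  then show ?thesis
    using assms by (simp add: V_def)
qed

text \<open>The Lyapunov equation recovers \<open>B p\<close> from \<open>W p\<close>, and the rank
  condition recovers \<open>p\<close> from \<open>B p\<close>.\<close>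

lemma W_injective:
  assumes rank: "vec_space.rank (N\<^sup>2) (M_AECS Q bm) = n"
    and p: "p \<in> carrier_vec n" and r: "r \<in> carrier_vec n" and eq: "W p = W r"
  shows "p = r"
proof -
  have B_eq: "B p $$ (a, b) = B r $$ (a, b)" if "a < N" "b < N" for a b
  proof -
    let ?S = "Jm * W r + W r * mat_adjoint Jm"
    have "(?S + B p) $$ (a, b) = (?S + B r) $$ (a, b)"
      using W_solves(2)[of p] W_solves(2)[of r] by (simp add: eq)
    then show ?thesis
      using that B_carrier[of p] B_carrier[of r] by simp
  qed
  have "p $ i - r $ i = 0" if "i < n" for i
  proof (rule rank_one_sums_injective[OF rank _ that])
    fix a b assume "a < N" "b < N"
    from B_eq[OF this] show "(\<Sum>i<n. complex_of_real (p $ i - r $ i) * P $$ (a, i) * cnj (P $$ (b, i))) = 0"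
      by (simp add: B_index[OF \<open>a < N\<close> \<open>b < N\<close>] sum_subtractf left_diff_distrib)
  qed
  then show ?thesis
    using p r by (intro eq_vecI) auto
qed

text \<open>Taking adjoints in \<open>P * E = 1\<close> yields a left inverse of the adjoint of
  \<open>P\<close>.\<close>

lemma adjoint_P_inj:
  assumes x: "x \<in> carrier_vec N" and zero: "\<And>i. i < n \<Longrightarrow> q i \<bullet>c x = 0"
  shows "x = 0\<^sub>v N"
proof -
  have Pa: "mat_adjoint P \<in> carrier_mat n N" and Ea: "mat_adjoint E \<in> carrier_mat N n"
    using P_carrier E_carrier by (auto intro: mat_adjoint_carrier)
  have "(mat_adjoint P *\<^sub>v x) $ i = cnj (q i \<bullet>c x)" if "i < n" for i
    using that x P_carrier by (simp add: scalar_prod_def mult.commute)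
  then have "mat_adjoint P *\<^sub>v x = 0\<^sub>v n"
    using zero P_carrier by (intro eq_vecI) (auto simp del: index_mult_mat_vec)
  moreover have "mat_adjoint E *\<^sub>v 0\<^sub>v n = 0\<^sub>v N"
    using Ea by (intro eq_vecI) (auto simp: scalar_prod_def)
  ultimately have "mat_adjoint E *\<^sub>v (mat_adjoint P *\<^sub>v x) = 0\<^sub>v N"
    by simp
  moreover have "mat_adjoint E * mat_adjoint P = 1\<^sub>m N"
  proof -
    have "mat_adjoint (1\<^sub>m N :: complex mat) = 1\<^sub>m N"
      by (intro eq_matI) auto
    then show ?thesis
      using mat_adjoint_mult[OF P_carrier E_carrier] by (simp add: P_E)
  qed
  ultimately show ?thesis
    using x Pa Ea by (simp flip: assoc_mult_mat_vec[of _ N n _ N])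
qed

lemma B_form:
  assumes x: "x \<in> carrier_vec N"
  shows "(B p *\<^sub>v x) \<bullet>c x = (\<Sum>i<n. p $ i * (cmod (q i \<bullet>c x))\<^sup>2)"
proof -
  have qx: "q i \<bullet>c x = (\<Sum>a<N. P $$ (a, i) * cnj (x $ a))" if "i < n" for i
    using that x P_carrier by (simp add: scalar_prod_def atLeast0LessThan)
  have "(B p *\<^sub>v x) \<bullet>c x = (\<Sum>a<N. \<Sum>b<N. \<Sum>i<n. p $ i * P $$ (a, i) * cnj (P $$ (b, i)) * x $ b * cnj (x $ a))"
    using x B_carrier[of p]
    by (simp add: scalar_prod_def atLeast0LessThan B_index sum_distrib_right)
  also have "\<dots> = (\<Sum>a<N. \<Sum>i<n. \<Sum>b<N. p $ i * P $$ (a, i) * cnj (P $$ (b, i)) * x $ b * cnj (x $ a))"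
    by (intro sum.cong refl sum.swap)
  also have "\<dots> = (\<Sum>i<n. \<Sum>a<N. \<Sum>b<N. p $ i * P $$ (a, i) * cnj (P $$ (b, i)) * x $ b * cnj (x $ a))"
    by (rule sum.swap)
  also have "\<dots> = (\<Sum>i<n. p $ i * ((q i \<bullet>c x) * cnj (q i \<bullet>c x)))"
    by (intro sum.cong refl) (simp add: qx sum_product sum_distrib_left mult_ac)
  finally show ?thesis
    by (simp flip: complex_norm_square)
qed

text \<open>All weights are positive and no nonzero vector is orthogonal to every
  \<open>q i\<close>, so \<open>B\<close> is positive definite here, and
  \<open>lyapunov_pos_def\<close> passes this on to \<open>W\<close>.\<close>

lemma uniform_pos_def:
  "pos_def (W (vec n (\<lambda>_. 1 / n)))"
proof (rule lyapunov_pos_def[OF Jm_carrier Jm_upper Jm_stable W_solves(1) W_hermitian B_carrier _ W_solves(2)])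
  let ?u = "vec n (\<lambda>_. 1 / n) :: real vec"
  show "pos_def (B ?u)"
    unfolding pos_def_iff[OF B_carrier]
  proof (intro conjI ballI impI)
    fix x :: "complex vec"
    assume x: "x \<in> carrier_vec N" "x \<noteq> 0\<^sub>v N"
    then obtain i where i: "i < n" "q i \<bullet>c x \<noteq> 0"
      using adjoint_P_inj by blast
    have "0 < (\<Sum>i<n. 1 / n * (cmod (q i \<bullet>c x))\<^sup>2)"
      using i by (intro sum_pos2[of _ i]) auto
    moreover have "(B ?u *\<^sub>v x) \<bullet>c x = complex_of_real (\<Sum>i<n. 1 / n * (cmod (q i \<bullet>c x))\<^sup>2)"
      by (simp add: B_form[OF x(1)])
    ultimately show "0 < Re ((B ?u *\<^sub>v x) \<bullet>c x)"
      by (simp only: Re_complex_of_real)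
  qed (rule B_hermitian)
qed

lemma cost_eq:
  assumes "pos_def (W p)"
  shows "aecs_cost Q bm bz bp p = (\<Sum>i<n. Re ((mat_inv (W p) *\<^sub>v q i) \<bullet>c q i))"
proof -
  define V where "V = mat_inv (W p)"
  define D where "D = diag_block_mat [V, 0\<^sub>m (total_size bz) (total_size bz), 0\<^sub>m (total_size bp) (total_size bp)]"
  have V: "V \<in> carrier_mat N N"
    using mat_inv_invertible(1)[OF W_solves(1) pos_def_invertible[OF W_solves(1) assms]] by (simp add: V_def)
  have D: "D \<in> carrier_mat n n"
    using V block_sizes by (intro carrier_matI) (auto simp: D_def dim_diag_block_mat)
  have D_index: "D $$ (a, b) = (if a < N \<and> b < N then V $$ (a, b) else 0)" if "a < n" "b < n" for a b
    using that V block_sizes by (auto simp: D_def Let_def)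
  have Ra: "mat_adjoint R \<in> carrier_mat n n"
    using R_inverse(1) by simp
  have diag: "(mat_adjoint R * D * R) $$ (i, i) = (V *\<^sub>v q i) \<bullet>c q i" if i: "i < n" for i
  proof -
    have "(mat_adjoint R * D * R) $$ (i, i) = (mat_adjoint R * (D * R)) $$ (i, i)"
      using Ra D R_inverse(1) by (simp add: assoc_mult_mat[of _ n n _ n _ n])
    also have "\<dots> = (\<Sum>a\<in>{0..<n}. \<Sum>b\<in>{0..<n}. cnj (R $$ (a, i)) * (D $$ (a, b) * R $$ (b, i)))"
      using i D R_inverse(1) by (simp add: scalar_prod_def sum_distrib_left)
    \<comment> \<open>\<open>D\<close> is supported on its leading block of size \<open>N\<close>,
      so both sums shrink and only the rows of \<open>R\<close> that belong to \<open>P\<close>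
      remain.\<close>
    also have "\<dots> = (\<Sum>a\<in>{0..<n}. \<Sum>b\<in>{0..<N}. cnj (R $$ (a, i)) * (D $$ (a, b) * R $$ (b, i)))"
      using N_le by (intro sum.cong refl sum.mono_neutral_right) (auto simp: D_index)
    also have "\<dots> = (\<Sum>a\<in>{0..<N}. \<Sum>b\<in>{0..<N}. cnj (R $$ (a, i)) * (D $$ (a, b) * R $$ (b, i)))"
      using N_le by (intro sum.mono_neutral_right) (auto simp: D_index)
    also have "\<dots> = (\<Sum>a\<in>{0..<N}. \<Sum>b\<in>{0..<N}. V $$ (a, b) * P $$ (b, i) * cnj (P $$ (a, i)))"
      using N_le i by (intro sum.cong refl) (auto simp: D_index P_index)
    also have "\<dots> = (V *\<^sub>v q i) \<bullet>c q i"
      using i V P_carrier by (simp add: scalar_prod_def sum_distrib_right)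
    finally show ?thesis .
  qed
  have "aecs_cost Q bm bz bp p = Re (mat_trace (mat_adjoint R * D * R))"
    by (simp add: aecs_cost_def D_def V_def)
  also have "\<dots> = Re (\<Sum>i<n. (V *\<^sub>v q i) \<bullet>c q i)"
    using diag R_inverse(1) by (simp add: mat_trace_def)
  finally show ?thesis
    by (simp add: V_def)
qed

section \<open>Existence and uniqueness of the optimum\<close>

abbreviation "h p x \<equiv> Re ((W p *\<^sub>v x) \<bullet>c x)"

text \<open>One trial vector per index; for fixed trial vectors the value is affine in
  \<open>p\<close> and makes sense even where \<open>W p\<close> is singular.\<close>

definition dual_cost :: "real vec \<Rightarrow> (nat \<Rightarrow> complex vec) \<Rightarrow> real" where
  "dual_cost p x = (\<Sum>i<n. 2 * Re (q i \<bullet>c x i) - h p (x i))"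

lemma h_linear:
  assumes x: "x \<in> carrier_vec N"
  shows "h p x = (\<Sum>i<n. p $ i * h (unit_vec n i) x)"
proof -
  have W_form: "(W p *\<^sub>v x) \<bullet>c x = (\<Sum>a<N. \<Sum>b<N. W p $$ (a, b) * (x $ b * cnj (x $ a)))" for p
    using x by (simp add: scalar_prod_def atLeast0LessThan sum_distrib_left sum_distrib_right mult_ac)
  have "(W p *\<^sub>v x) \<bullet>c x = (\<Sum>a<N. \<Sum>b<N. \<Sum>i<n. p $ i * W (unit_vec n i) $$ (a, b) * (x $ b * cnj (x $ a)))"
    by (simp add: W_form W_linear[of _ _ p] sum_distrib_right)
  also have "\<dots> = (\<Sum>a<N. \<Sum>i<n. \<Sum>b<N. p $ i * W (unit_vec n i) $$ (a, b) * (x $ b * cnj (x $ a)))"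
    by (intro sum.cong refl sum.swap)
  also have "\<dots> = (\<Sum>i<n. \<Sum>a<N. \<Sum>b<N. p $ i * W (unit_vec n i) $$ (a, b) * (x $ b * cnj (x $ a)))"
    by (rule sum.swap)
  also have "\<dots> = (\<Sum>i<n. p $ i * ((W (unit_vec n i) *\<^sub>v x) \<bullet>c x))"
    by (simp add: W_form sum_distrib_left mult.assoc)
  finally show ?thesis by simp
qed

text \<open>The bound of \<open>dual_form_bound\<close> is summed over the indices. The gaps are
  nonnegative, so equality of the sums forces equality in every term.\<close>

lemma dual_cost_le:
  assumes p: "pos_def (W p)" and x: "\<And>i. i < n \<Longrightarrow> x i \<in> carrier_vec N"
  shows "dual_cost p x \<le> aecs_cost Q bm bz bp p"
    and "dual_cost p x = aecs_cost Q bm bz bp p \<longleftrightarrow> (\<forall>i<n. W p *\<^sub>v x i = q i)"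
proof -
  have le: "2 * Re (q i \<bullet>c x i) - h p (x i) \<le> Re ((mat_inv (W p) *\<^sub>v q i) \<bullet>c q i)" if "i < n" for i
    using dual_form_bound(1)[OF W_solves(1) p q_carrier x] that by simp
  show "dual_cost p x \<le> aecs_cost Q bm bz bp p"
    unfolding dual_cost_def cost_eq[OF p] by (intro sum_mono le) simp
  have "dual_cost p x = aecs_cost Q bm bz bp p \<longleftrightarrow>
      (\<Sum>i<n. Re ((mat_inv (W p) *\<^sub>v q i) \<bullet>c q i) - (2 * Re (q i \<bullet>c x i) - h p (x i))) = 0"
    unfolding dual_cost_def cost_eq[OF p] by (subst sum_subtractf) auto
  also have "\<dots> \<longleftrightarrow> (\<forall>i<n. 2 * Re (q i \<bullet>c x i) - h p (x i) = Re ((mat_inv (W p) *\<^sub>v q i) \<bullet>c q i))"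
    using le by (subst sum_nonneg_eq_0_iff) auto
  also have "\<dots> \<longleftrightarrow> (\<forall>i<n. W p *\<^sub>v x i = q i)"
    using dual_form_bound(2)[OF W_solves(1) p q_carrier x] by simp
  finally show "dual_cost p x = aecs_cost Q bm bz bp p \<longleftrightarrow> (\<forall>i<n. W p *\<^sub>v x i = q i)" .
qed

lemma cost_eq_dual_cost:
  assumes p: "pos_def (W p)"
  obtains x where "\<And>i. i < n \<Longrightarrow> x i \<in> carrier_vec N" "\<And>i. i < n \<Longrightarrow> W p *\<^sub>v x i = q i"
    "aecs_cost Q bm bz bp p = dual_cost p x"
proof -
  note inv = mat_inv_invertible[OF W_solves(1) pos_def_invertible[OF W_solves(1) p]]
  define x where "x i = mat_inv (W p) *\<^sub>v q i" for i
  have x: "x i \<in> carrier_vec N" "W p *\<^sub>v x i = q i" if "i < n" for i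
    using inv that W_solves(1)[of p] by (auto simp: x_def simp flip: assoc_mult_mat_vec[of _ N N _ N])
  with dual_cost_le(2)[OF p, of x] show ?thesis
    by (intro that[of x]) auto
qed

lemma optimal_exists:
  assumes N: "1 \<le> N"
  shows "\<exists>p. aecs_optimal Q bm bz bp p"
proof -
  let ?F = "aecs_feasible Q bm" and ?f = "aecs_cost Q bm bz bp"
  have feasible: "p \<in> ?F \<longleftrightarrow> p \<in> prob_simplex n \<and> pos_def (W p)" for p
    by (simp add: aecs_feasible_def)
  \<comment> \<open>\<open>1 \<le> N\<close> and \<open>N \<le> n\<close> exclude
    \<open>n = 0\<close>, so the uniform weights do sum to 1.\<close>
  have "vec n (\<lambda>_. 1 / n) \<in> ?F"
    using uniform_pos_def N N_le by (simp add: feasible prob_simplex_def)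
  then have ne: "?f ` ?F \<noteq> {}" by blast
  \<comment> \<open>Zero trial vectors give the dual cost 0, a lower bound.\<close>
  have "0 \<le> ?f p" if "p \<in> ?F" for p
  proof -
    have "dual_cost p (\<lambda>_. 0\<^sub>v N) \<le> ?f p"
      using that by (intro dual_cost_le(1)) (auto simp: feasible)
    moreover have "dual_cost p (\<lambda>_. 0\<^sub>v N) = 0"
      unfolding dual_cost_def
      by (intro sum.neutral ballI)
        (simp add: scalar_prod_right_zero[OF q_carrier] scalar_prod_right_zero[OF mult_mat_vec_carrier[OF W_solves(1)]])
    ultimately show ?thesis by simp
  qed
  then have bdd: "bdd_below (?f ` ?F)"
    by (intro bdd_belowI[of _ 0]) auto
  define m where "m = Inf (?f ` ?F)"
  have "\<exists>p \<in> ?F. ?f p < m + 1 / Suc k" for k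
  proof -
    have "Inf (?f ` ?F) < m + 1 / Suc k"
      by (simp add: m_def)
    from cInf_lessD[OF ne this] show ?thesis
      by blast
  qed
  then obtain p where p: "\<And>k. p k \<in> ?F" "\<And>k. ?f (p k) < m + 1 / Suc k"
    by metis
  then obtain r l where r: "strict_mono r" and l: "l \<in> prob_simplex n"
    and lim: "\<And>i. i < n \<Longrightarrow> (\<lambda>k. p (r k) $ i) \<longlonglongrightarrow> l $ i"
    using prob_simplex_compact[of p n] feasible by blast
  have h_lim: "(\<lambda>k. h (p (r k)) x) \<longlonglongrightarrow> h l x" if "x \<in> carrier_vec N" for x
    unfolding h_linear[OF that, of "p (r _)"] h_linear[OF that, of l]
    using lim by (intro tendsto_sum tendsto_mult tendsto_const) auto
  \<comment> \<open>The trial vectors are fixed before passing to the limit, so the bound is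
    available before \<open>l\<close> is known to be feasible.\<close>
  have bound: "dual_cost l x \<le> m" if x: "\<And>i. i < n \<Longrightarrow> x i \<in> carrier_vec N" for x
  proof (rule LIMSEQ_le)
    show "(\<lambda>k. dual_cost (p (r k)) x) \<longlonglongrightarrow> dual_cost l x"
      unfolding dual_cost_def using x by (intro tendsto_sum tendsto_diff tendsto_const h_lim) auto
    have "(\<lambda>k. 1 / real (Suc (r k))) \<longlonglongrightarrow> 0"
      using LIMSEQ_subseq_LIMSEQ[OF LIMSEQ_inverse_real_of_nat r] by (simp add: o_def inverse_eq_divide)
    then show "(\<lambda>k. m + 1 / real (Suc (r k))) \<longlonglongrightarrow> m"
      using tendsto_add[OF tendsto_const[of m]] by fastforce
    show "\<exists>K. \<forall>k\<ge>K. dual_cost (p (r k)) x \<le> m + 1 / real (Suc (r k))"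
    proof (intro exI allI impI)
      fix k
      have "dual_cost (p (r k)) x \<le> ?f (p (r k))"
        using p(1)[of "r k"] x by (intro dual_cost_le(1)) (auto simp: feasible)
      then show "dual_cost (p (r k)) x \<le> m + 1 / real (Suc (r k))"
        using p(2)[of "r k"] by linarith
    qed
  qed
  have pd: "pos_def (W l)"
    unfolding pos_def_iff[OF W_solves(1)]
  proof (intro conjI ballI impI)
    fix x :: "complex vec"
    assume x: "x \<in> carrier_vec N" "x \<noteq> 0\<^sub>v N"
    have "0 \<le> h (p (r k)) x" for k
      using p(1)[of "r k"] by (intro pos_def_form_nonneg[OF W_solves(1) _ x(1)]) (simp add: feasible)
    then have "0 \<le> h l x"
      using LIMSEQ_le_const[OF h_lim[OF x(1)]] by blast
    moreover have "h l x \<noteq> 0"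
    proof
      assume h0: "h l x = 0"
      obtain i where i: "i < n" "q i \<bullet>c x \<noteq> 0"
        using adjoint_P_inj x by blast
      define z where "z = q i \<bullet>c x"
      \<comment> \<open>The form of \<open>W l\<close> vanishes on all multiples of
        \<open>x\<close>, so only the linear term counts. The factor \<open>t\<close> is scaled to
        make that term equal to \<open>m + 1\<close>, which exceeds the bound
        \<open>m\<close>.\<close>
      define t where "t = complex_of_real ((m + 1) / (2 * (cmod z)\<^sup>2)) * z"
      have z: "z \<noteq> 0" using i by (simp add: z_def)
      define y where "y j = (if j = i then t \<cdot>\<^sub>v x else 0\<^sub>v N)" for j
      have y: "y j \<in> carrier_vec N" for j
        using x by (simp add: y_def)
      have ht: "h l (t \<cdot>\<^sub>v x) = 0"
        using h0 hermitian_form_real[OF W_solves(1) W_hermitian x(1), of l] x(1)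
        by (simp add: form_smult[OF W_solves(1)] complex_eq_iff)
      have tx: "q i \<bullet>c (t \<cdot>\<^sub>v x) = cnj t * z"
        by (simp add: z_def conjugate_smult_vec
            scalar_prod_smult_distrib[OF q_carrier[OF i(1)] carrier_vec_conjugate[OF x(1)]])
      have "cnj t * z = complex_of_real ((m + 1) / 2)"
      proof -
        have "cnj t * z = complex_of_real ((m + 1) / (2 * (cmod z)\<^sup>2)) * (complex_of_real ((cmod z)\<^sup>2))"
          by (simp only: t_def complex_norm_square complex_cnj_mult complex_cnj_complex_of_real mult_ac)
        moreover have "(m + 1) / (2 * (cmod z)\<^sup>2) * (cmod z)\<^sup>2 = (m + 1) / 2"
          using z by simp
        ultimately show ?thesis
          by (simp only: flip: of_real_mult)
      qed
      then have "Re (q i \<bullet>c (t \<cdot>\<^sub>v x)) = (m + 1) / 2"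
        by (simp only: tx Re_complex_of_real)
      then have "2 * Re (q i \<bullet>c y i) - h l (y i) = m + 1"
        by (simp add: y_def ht)
      moreover have "2 * Re (q j \<bullet>c y j) - h l (y j) = 0" if "j < n" "j \<noteq> i" for j
        using that scalar_prod_right_zero[OF q_carrier] scalar_prod_right_zero[OF mult_mat_vec_carrier[OF W_solves(1)]]
        by (simp add: y_def)
      ultimately have "dual_cost l y = (\<Sum>j<n. if j = i then m + 1 else 0)"
        unfolding dual_cost_def by (intro sum.cong) auto
      then show False
        using bound[of y] y i by simp
    qed
    ultimately show "0 < Re ((W l *\<^sub>v x) \<bullet>c x)"
      by simp
  qed (rule W_hermitian)
  \<comment> \<open>The bound by \<open>m\<close> is now applied to the maximizers belonging to
    \<open>l\<close> itself.\<close>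
  obtain x where "\<And>i. i < n \<Longrightarrow> x i \<in> carrier_vec N" "?f l = dual_cost l x"
    using cost_eq_dual_cost[OF pd] by metis
  then have "?f l \<le> m"
    using bound by simp
  moreover have "m \<le> ?f s" if "s \<in> ?F" for s
    unfolding m_def using that bdd by (intro cInf_lower) auto
  ultimately have "aecs_optimal Q bm bz bp l"
    using l pd by (fastforce simp: aecs_optimal_def feasible)
  then show ?thesis ..
qed

text \<open>The hypothesis says \<open>X * P = P\<close>, and \<open>P\<close> can be cancelled with
  its right inverse \<open>E\<close>.\<close>

lemma mat_eq_one_if_fixes_q:
  assumes X: "X \<in> carrier_mat N N" and fixed: "\<And>i. i < n \<Longrightarrow> X *\<^sub>v q i = q i"
  shows "X = 1\<^sub>m N"
proof -
  have "X * P = P"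
  proof (rule eq_matI)
    fix a i assume "a < dim_row P" "i < dim_col P"
    then have ai: "a < N" "i < n" using P_carrier by auto
    have "(X * P) $$ (a, i) = (X *\<^sub>v q i) $ a"
      using X P_carrier ai by simp
    also have "\<dots> = P $$ (a, i)"
      using P_carrier ai by (simp add: fixed del: index_mult_mat_vec)
    finally show "(X * P) $$ (a, i) = P $$ (a, i)" .
  qed (use X P_carrier in auto)
  then have "X * (P * E) = P * E"
    using assoc_mult_mat[OF X P_carrier E_carrier] by simp
  then show ?thesis
    using X by (simp add: P_E)
qed

lemma optimal_unique:
  assumes rank: "vec_space.rank (N\<^sup>2) (M_AECS Q bm) = n"
    and p: "aecs_optimal Q bm bz bp p" and r: "aecs_optimal Q bm bz bp r"
  shows "p = r"
proof -
  let ?f = "aecs_cost Q bm bz bp"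
  define u where "u = vec n (\<lambda>i. (p $ i + r $ i) / 2)"
  have ps: "p \<in> prob_simplex n" "pos_def (W p)" and rs: "r \<in> prob_simplex n" "pos_def (W r)"
    using p r by (auto simp: aecs_optimal_def aecs_feasible_def)
  have h_u: "h u x = (h p x + h r x) / 2" if "x \<in> carrier_vec N" for x
  proof -
    have "h u x = (\<Sum>i<n. (p $ i * h (unit_vec n i) x + r $ i * h (unit_vec n i) x) / 2)"
      unfolding h_linear[OF that, of u] by (intro sum.cong refl) (simp add: u_def field_simps)
    then show ?thesis
      by (simp only: h_linear[OF that, of p] h_linear[OF that, of r] sum.distrib flip: sum_divide_distrib)
  qed
  have upd: "pos_def (W u)"
    unfolding pos_def_iff[OF W_solves(1)]
  proof (intro conjI ballI impI)
    fix x :: "complex vec" assume x: "x \<in> carrier_vec N" "x \<noteq> 0\<^sub>v N"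
    then have "0 < h p x" "0 < h r x"
      using ps(2) rs(2) by (auto simp: pos_def_iff[OF W_solves(1)])
    then show "0 < h u x"
      by (simp add: h_u[OF x(1)])
  qed (rule W_hermitian)
  have "(\<Sum>i<n. (p $ i + r $ i) / 2) = 1"
    using ps(1) rs(1) by (simp add: prob_simplex_def sum.distrib flip: sum_divide_distrib)
  then have "u \<in> prob_simplex n"
    using ps(1) rs(1) by (simp add: prob_simplex_def u_def)
  with upd have "u \<in> aecs_feasible Q bm"
    by (simp add: aecs_feasible_def)
  then have min: "?f p \<le> ?f u" "?f r \<le> ?f u"
    using p r by (auto simp: aecs_optimal_def)
  obtain x where x: "\<And>i. i < n \<Longrightarrow> x i \<in> carrier_vec N" and Wu: "\<And>i. i < n \<Longrightarrow> W u *\<^sub>v x i = q i"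
    and fu: "?f u = dual_cost u x"
    using cost_eq_dual_cost[OF upd] by metis
  have "dual_cost u x = (\<Sum>i<n. ((2 * Re (q i \<bullet>c x i) - h p (x i)) + (2 * Re (q i \<bullet>c x i) - h r (x i))) / 2)"
    unfolding dual_cost_def using x by (intro sum.cong) (auto simp: h_u field_simps)
  also have "\<dots> = (dual_cost p x + dual_cost r x) / 2"
    by (simp only: dual_cost_def sum.distrib flip: sum_divide_distrib)
  finally have "dual_cost u x = (dual_cost p x + dual_cost r x) / 2" .
  moreover have "dual_cost p x \<le> ?f p" "dual_cost r x \<le> ?f r"
    using dual_cost_le(1) ps(2) rs(2) x by blast+
  \<comment> \<open>The average of the two dual costs equals \<open>?f u\<close>, which is at least
    \<open>?f p\<close> and \<open>?f r\<close>, while each dual cost is at most the corresponding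
    cost. Neither bound can be strict.\<close>
  ultimately have "dual_cost p x = ?f p \<and> dual_cost r x = ?f r"
    using min fu by argo
  then have Wpr: "W p *\<^sub>v x i = q i" "W r *\<^sub>v x i = q i" if "i < n" for i
    using that dual_cost_le(2)[of p x, OF ps(2) x] dual_cost_le(2)[of r x, OF rs(2) x] by auto
  note inv = mat_inv_invertible[OF W_solves(1) pos_def_invertible[OF W_solves(1) upd]]
  have x_eq: "mat_inv (W u) *\<^sub>v q i = x i" if "i < n" for i
    using inv x[OF that] W_solves(1)[of u]
    by (simp flip: Wu[OF that] assoc_mult_mat_vec[of _ N N _ N])
  \<comment> \<open>Since \<open>x i\<close> is the image of \<open>q i\<close> under the inverse of
    \<open>W u\<close>, the product of \<open>W s\<close> with that inverse fixes every
    \<open>q i\<close> and is therefore the identity.\<close>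
  have "W s = W u" if s: "\<And>i. i < n \<Longrightarrow> W s *\<^sub>v x i = q i" for s
  proof -
    have "W s * mat_inv (W u) = 1\<^sub>m N"
      using inv(1) W_solves(1)[of s] s
      by (intro mat_eq_one_if_fixes_q) (auto simp: x_eq assoc_mult_mat_vec[of _ N N _ N])
    then have "W s * mat_inv (W u) * W u = W u"
      using W_solves(1)[of u] by simp
    then show ?thesis
      using W_solves(1)[of s] W_solves(1)[of u] inv by (simp add: assoc_mult_mat[of _ N N _ N _ N])
  qed
  then have "W p = W r"
    using Wpr by metis
  then show ?thesis
    using W_injective[OF rank] ps(1) rs(1) by (simp add: prob_simplex_def)
qed

end

theorem theorem5:
  fixes A :: "real mat" and Q :: "complex mat" and bm bz bp :: blocks and n :: nat
  assumes "A \<in> carrier_mat n n"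
    and "ordered_jordan_decomposition (map_mat complex_of_real A) Q bm bz bp"
    and "1 \<le> total_size bm"
    and "vec_space.rank ((total_size bm)\<^sup>2) (M_AECS Q bm) = n"
  shows "\<exists>!p. aecs_optimal Q bm bz bp p"
proof -
  interpret jordan_decomposition A Q bm bz bp n
    using assms(1,2) by unfold_locales
  show ?thesis
    using optimal_exists[OF assms(3)] optimal_unique[OF assms(4)] by blast
qed

end
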